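(* Let $m$ and $r$ be two integers such that $2\leq m<r$, and let $k$ be a positive integer. Let $G$ be a finite multigraph (loops allowed) which is $2r$-regular, $2m$-edge-connected and has an odd number of vertices. If one of the following conditions holds, then $G-v$ has a $k$-factor for every $v\in V(G)$: (i) $k$ is even and $2\leq k\leq m$; (ii) $k$ is odd, $3\leq k\leq m$ and $2m>r$.
   Context: All graphs are finite multigraphs, with parallel edges and loops allowed; the degree $d_G(v)$ of a vertex $v$ is the number of edges incident with $v$, with each loop counted twice (the usual convention). A graph is $2r$-regular if every vertex has degree $2r$. A graph is $2m$-edge-connected if it remains connected after the deletion of any set of fewer than $2m$ edges. For $v\in V(G)$, $G-v$ is the graph obtained from $G$ by deleting the vertex $v$ together with all edges incident with it. For a positive integer $k$, a $k$-factor of a graph $G$ is a spanning subgraph $H$ of $G$ such that $d_H(x)=k$ for every $x\in V(G)$. *)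

theory Defs
  imports Main "HOL-Library.Uprod"
begin

(* Edges have identities of their own, so edges with the same pair of ends are parallel.
   The ends of an edge form an unordered pair; a loop at v has ends Upair v v. *)
record ('v, 'e) multigraph =
  verts :: "'v set"
  edges :: "'e set"
  ends  :: "'e \<Rightarrow> 'v uprod"

locale finite_multigraph =
  fixes G :: "('v, 'e) multigraph"
  assumes finite_verts: "finite (verts G)"
    and finite_edges: "finite (edges G)"
    and ends_in_verts: "e \<in> edges G \<Longrightarrow> set_uprod (ends G e) \<subseteq> verts G"

(* The second summand counts each loop at v once more. *)
definition degree :: "('v, 'e) multigraph \<Rightarrow> 'v \<Rightarrow> nat" where
  "degree G v = card {e \<in> edges G. v \<in> set_uprod (ends G e)}
              + card {e \<in> edges G. ends G e = Upair v v}"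

definition regular :: "nat \<Rightarrow> ('v, 'e) multigraph \<Rightarrow> bool" where
  "regular d G \<longleftrightarrow> (\<forall>v \<in> verts G. degree G v = d)"

definition adjacency :: "('v, 'e) multigraph \<Rightarrow> ('v \<times> 'v) set" where
  "adjacency G = {(x, y). \<exists>e \<in> edges G. ends G e = Upair x y}"

definition connected :: "('v, 'e) multigraph \<Rightarrow> bool" where
  "connected G \<longleftrightarrow> verts G \<noteq> {} \<and> (\<forall>x \<in> verts G. \<forall>y \<in> verts G. (x, y) \<in> (adjacency G)\<^sup>*)"

definition delete_edges :: "('v, 'e) multigraph \<Rightarrow> 'e set \<Rightarrow> ('v, 'e) multigraph" where
  "delete_edges G F = G\<lparr>edges := edges G - F\<rparr>"

definition delete_vertex :: "('v, 'e) multigraph \<Rightarrow> 'v \<Rightarrow> ('v, 'e) multigraph" where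
  "delete_vertex G v =
     G\<lparr>verts := verts G - {v}, edges := {e \<in> edges G. v \<notin> set_uprod (ends G e)}\<rparr>"

(* Taking F = {} shows that, for l > 0, an l-edge-connected graph is connected.
   A one-vertex graph is l-edge-connected for every l. *)
definition edge_connected :: "nat \<Rightarrow> ('v, 'e) multigraph \<Rightarrow> bool" where
  "edge_connected l G \<longleftrightarrow> (\<forall>F \<subseteq> edges G. card F < l \<longrightarrow> connected (delete_edges G F))"

definition spanning_subgraph :: "('v, 'e) multigraph \<Rightarrow> ('v, 'e) multigraph \<Rightarrow> bool" where
  "spanning_subgraph H G \<longleftrightarrow>
     verts H = verts G \<and> edges H \<subseteq> edges G \<and> (\<forall>e \<in> edges H. ends H e = ends G e)"

definition is_factor :: "nat \<Rightarrow> ('v, 'e) multigraph \<Rightarrow> ('v, 'e) multigraph \<Rightarrow> bool" where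
  "is_factor k H G \<longleftrightarrow> spanning_subgraph H G \<and> (\<forall>x \<in> verts G. degree H x = k)"

definition has_factor :: "nat \<Rightarrow> ('v, 'e) multigraph \<Rightarrow> bool" where
  "has_factor k G \<longleftrightarrow> (\<exists>H. is_factor k H G)"

end

theory Submission
  imports Defs
begin

text \<open>If \<open>G - v\<close> has no \<open>k\<close>-factor, Tutte's factor theorem yields disjoint sets \<open>S\<close>, \<open>T\<close> of vertices
  and \<open>q\<close> disjoint sets \<open>K\<close>, closed in \<open>G - v - S - T\<close>, with \<open>k|K| + e(K,T)\<close> odd and
  \<open>k|S| + D + 2 \<le> k|T| + q\<close>, where \<open>D\<close> is the degree sum of \<open>T\<close> in \<open>G - v - S\<close>. Regularity bounds
  \<open>D\<close> from below in two ways: by the number \<open>A\<close> of edges from the sets \<open>K\<close> to \<open>T\<close>, and by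
  \<open>2r(|T| - |S| - 1) + B\<close>, where \<open>B\<close> counts the edges from the sets \<open>K\<close> to \<open>S\<close> and \<open>v\<close>. Every \<open>K\<close> is left by
  at least \<open>2m\<close> edges, so \<open>A + B \<ge> 2mq\<close>; suitable convex combinations of the two bounds contradict
  the inequality. When \<open>|T| = |S| + 1\<close> the odd order of \<open>G\<close> makes \<open>G - v - S - T\<close> nonempty, which gives
  \<open>D \<ge> m\<close>.

  The factor theorem comes from the Tutte--Berge formula, applied to Tutte's gadget graph and a
  barrier of minimal size. The Tutte--Berge formula is proved as in Schrijver's book, by Gallai's
  exchange argument.\<close>

subsection \<open>The Tutte--Berge formula\<close>

lemma pairwise_disjnt_insert:
  "pairwise disjnt \<C> \<Longrightarrow> (\<And>B. B \<in> \<C> \<Longrightarrow> disjnt A B) \<Longrightarrow> pairwise disjnt (insert A \<C>)"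
  by (simp add: pairwise_insert disjnt_sym)

text \<open>The vertex set is an argument of the notions below rather than part of the locale, so an
  induction can pass to smaller vertex sets with the same \<open>E\<close>.\<close>

locale simple_graph =
  fixes E :: "'a set set"
  assumes card_edge: "e \<in> E \<Longrightarrow> card e = 2"
begin

definition matching :: "'a set \<Rightarrow> 'a set set \<Rightarrow> bool" where
  "matching V M \<longleftrightarrow> M \<subseteq> E \<and> \<Union>M \<subseteq> V \<and> pairwise disjnt M"

definition max_matching :: "'a set \<Rightarrow> 'a set set \<Rightarrow> bool" where
  "max_matching V M \<longleftrightarrow> matching V M \<and> (\<forall>N. matching V N \<longrightarrow> card N \<le> card M)"

definition adj :: "'a set \<Rightarrow> ('a \<times> 'a) set" where
  "adj V = {(x, y). x \<in> V \<and> y \<in> V \<and> {x, y} \<in> E}"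

text \<open>The members need not be connected: unions of components of \<open>V - U\<close> serve as well and are
  closed under merging.\<close>

definition odd_family :: "'a set \<Rightarrow> 'a set \<Rightarrow> 'a set set \<Rightarrow> bool" where
  "odd_family V U \<C> \<longleftrightarrow> U \<subseteq> V \<and> \<Union>\<C> \<subseteq> V - U \<and> pairwise disjnt \<C> \<and> (\<forall>C\<in>\<C>. odd (card C))
     \<and> (\<forall>C\<in>\<C>. \<forall>x\<in>C. \<forall>y\<in>V - U. {x, y} \<in> E \<longrightarrow> y \<in> C)"

lemma finite_edge: "e \<in> E \<Longrightarrow> finite e"
  using card_edge card.infinite by fastforce

lemma edge_neq: "{x, y} \<in> E \<Longrightarrow> x \<noteq> y"
  using card_edge[of "{x, y}"] by auto

lemma edge_other:
  assumes "e \<in> E" "x \<in> e" obtains y where "e = {x, y}" "y \<noteq> x"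
proof -
  obtain a b where "e = {a, b}" "a \<noteq> b" using card_edge[OF assms(1)] by (auto simp: card_2_iff)
  then show thesis using assms(2) that by (metis insert_commute insert_iff singletonD)
qed

lemma matching_unique:
  "matching V M \<Longrightarrow> e \<in> M \<Longrightarrow> e' \<in> M \<Longrightarrow> x \<in> e \<Longrightarrow> x \<in> e' \<Longrightarrow> e = e'"
  unfolding matching_def pairwise_def disjnt_def by blast

lemma finite_matching: "finite V \<Longrightarrow> matching V M \<Longrightarrow> finite M"
  unfolding matching_def by (meson finite_UnionD finite_subset)

lemma card_Union_matching: "matching V M \<Longrightarrow> card (\<Union>M) = 2 * card M"
proof -
  assume M: "matching V M"
  then have "card (\<Union>M) = (\<Sum>e\<in>M. card e)"
    by (intro card_Union_disjoint) (auto simp: matching_def finite_edge)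
  also have "\<dots> = (\<Sum>e\<in>M. 2)" using M by (intro sum.cong) (auto simp: matching_def card_edge)
  finally show ?thesis by simp
qed

lemma ex_max_matching:
  assumes "finite V" shows "\<exists>M. max_matching V M"
proof -
  have bd: "card M \<le> card V" if "matching V M" for M
  proof -
    have "2 * card M \<le> card V"
      using card_Union_matching[OF that] card_mono[OF assms, of "\<Union>M"] that by (simp add: matching_def)
    then show ?thesis by simp
  qed
  have "matching V {}" by (simp add: matching_def)
  then show ?thesis
    using ex_has_greatest_nat[of "matching V" "{}" card "Suc (card V)"] bd
    by (auto simp: max_matching_def less_Suc_eq_le)
qed

lemma matching_insert:
  "matching V M \<Longrightarrow> {x, y} \<in> E \<Longrightarrow> x \<in> V - \<Union>M \<Longrightarrow> y \<in> V - \<Union>M \<Longrightarrow> matching V (insert {x, y} M)"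
  unfolding matching_def pairwise_insert by (auto simp: disjnt_def)

lemma max_matching_not_adj:
  assumes V: "finite V" and M: "max_matching V M" and x: "x \<in> V - \<Union>M" and y: "y \<in> V - \<Union>M"
  shows "{x, y} \<notin> E"
proof
  assume e: "{x, y} \<in> E"
  have "matching V (insert {x, y} M)" using matching_insert M e x y by (auto simp: max_matching_def)
  then have "card (insert {x, y} M) \<le> card M" using M by (auto simp: max_matching_def)
  moreover have "{x, y} \<notin> M" using x by auto
  moreover have "finite M" using finite_matching V M by (auto simp: max_matching_def)
  ultimately show False by simp
qed

text \<open>The exchange argument of Gallai's lemma, by induction on the distance of the two
  uncovered vertices.\<close>

lemma uncovered_not_connected:
  assumes V: "finite V" and missed: "\<And>x. x \<in> V \<Longrightarrow> \<exists>N. max_matching V N \<and> x \<notin> \<Union>N"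
  shows "max_matching V M \<Longrightarrow> u \<in> V - \<Union>M \<Longrightarrow> v \<in> V - \<Union>M \<Longrightarrow> u \<noteq> v \<Longrightarrow> (u, v) \<notin> adj V ^^ n"
proof (induction n arbitrary: M u v rule: less_induct)
  case (less n)
  note M = less.prems(1) and u = less.prems(2) and v = less.prems(3) and uv = less.prems(4)
  consider "n = 0" | "n = 1" | j where "n = Suc (Suc j)" by (metis One_nat_def not0_implies_Suc)
  then show ?case
  proof cases
    case 1 then show ?thesis using uv by auto
  next
    case 2 then show ?thesis using max_matching_not_adj[OF V M u v] by (auto simp: adj_def)
  next
    case (3 j)
    show ?thesis
    proof
      assume "(u, v) \<in> adj V ^^ n"
      \<comment> \<open>Here \<open>t\<close> is the vertex after \<open>u\<close> on the walk. Its
        walks to \<open>u\<close> and to \<open>v\<close> are both shorter than \<open>n\<close>, so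
        the induction hypothesis speaks about every maximum matching that misses
        \<open>t\<close>.\<close>
      then obtain t where ut: "(u, t) \<in> adj V ^^ 1" and tv: "(t, v) \<in> adj V ^^ Suc j"
        unfolding 3 by (metis One_nat_def relpow_1 relpow_Suc_D2)
      have t: "t \<in> V" "u \<noteq> t" using ut edge_neq by (auto simp: adj_def)
      have "t \<in> \<Union>M" using less.IH[OF _ M u _ t(2), of 1] ut t 3 by auto
      then have tv': "t \<noteq> v" using v by auto
      \<comment> \<open>Among the maximum matchings missing \<open>t\<close>, one that shares the
        most edges with \<open>M\<close> is chosen; the contradiction will be one that shares
        more.\<close>
      define P where "P N \<longleftrightarrow> max_matching V N \<and> t \<notin> \<Union>N" for N
      obtain N0 where N0: "P N0" using missed[OF t(1)] unfolding P_def by blast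
      have finM: "finite M" using finite_matching V M by (auto simp: max_matching_def)
      have "card (M \<inter> N) < Suc (card M)" for N
        using card_mono[OF finM, of "M \<inter> N"] by simp
      then obtain N where PN: "P N" and Nmax: "\<And>N'. P N' \<Longrightarrow> card (M \<inter> N') \<le> card (M \<inter> N)"
        using ex_has_greatest_nat[of P N0 "\<lambda>N. card (M \<inter> N)" "Suc (card M)", OF N0] by auto
      have N: "max_matching V N" "t \<notin> \<Union>N" using PN by (simp_all add: P_def)
      have mM: "matching V M" and mN: "matching V N" using M N by (auto simp: max_matching_def)
      have finN: "finite N" using finite_matching V mN by auto
      \<comment> \<open>Otherwise \<open>N\<close> would miss \<open>t\<close> together with
        \<open>u\<close> or \<open>v\<close>, against the induction hypothesis.\<close>
      have uN: "u \<in> \<Union>N" using less.IH[of 1 N u t] N ut t u 3 by auto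
      have vN: "v \<in> \<Union>N" using less.IH[of "Suc j" N t v] N tv tv' t v 3 by auto
      have "card M = card N" using M N by (simp add: max_matching_def le_antisym)
      then have ceq: "card (\<Union>M) = card (\<Union>N)" using card_Union_matching mM mN by simp
      have fin: "finite (\<Union>M)" "finite (\<Union>N)"
        using mM mN V finite_subset by (auto simp: matching_def)
      \<comment> \<open>\<open>M\<close> and \<open>N\<close> cover equally many vertices and only
        \<open>N\<close> covers \<open>u\<close> and \<open>v\<close>, so \<open>M\<close> covers at
        least two vertices that \<open>N\<close> misses, one of them different from
        \<open>t\<close>.\<close>
      have "card (\<Union>M - \<Union>N) = card (\<Union>N - \<Union>M)"
        using ceq fin by (simp add: card_Diff_subset_Int Int_commute)
      also have "\<dots> \<ge> card {u, v}" using uN vN u v fin by (intro card_mono) auto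
      finally have "\<not> card (\<Union>M - \<Union>N) \<le> card {t}" using uv by simp
      then have "\<not> \<Union>M - \<Union>N \<subseteq> {t}" by (metis card_mono finite.emptyI finite_insert)
      then obtain x where x: "x \<in> \<Union>M" "x \<notin> \<Union>N" "x \<noteq> t" by blast
      then obtain e where e: "e \<in> M" "x \<in> e" by blast
      have eE: "e \<in> E" using e mM by (auto simp: matching_def)
      obtain y where y: "e = {x, y}" "y \<noteq> x" using edge_other[OF eE e(2)] .
      have xyV: "x \<in> V" "y \<in> V" using e y mM by (auto simp: matching_def)
      have "y \<in> \<Union>N"
        using max_matching_not_adj[OF V, of N x y] N x xyV y eE by blast
      then obtain f where f: "f \<in> N" "y \<in> f" by blast
      have fM: "f \<notin> M" using matching_unique[OF mM, of f e y] e f y x by auto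
      \<comment> \<open>Exchanging \<open>f\<close> for the edge \<open>{x, y}\<close> of
        \<open>M\<close> keeps the size and still misses \<open>t\<close>, but gains a common edge
        with \<open>M\<close>, since \<open>f\<close> is not in \<open>M\<close>.\<close>
      let ?N = "insert {x, y} (N - {f})"
      have mN': "matching V (N - {f})" using mN by (auto simp: matching_def pairwise_def)
      have "y \<notin> \<Union>(N - {f})" using matching_unique[OF mN f(1) _ f(2)] by blast
      then have m: "matching V ?N" using matching_insert[OF mN', of x y] eE y x xyV by auto
      have nin: "{x, y} \<notin> N" using x by auto
      have "card ?N = card N" using finN f nin
        by (metis card_Suc_Diff1 card_insert_disjoint finite_Diff insert_Diff insert_iff)
      then have "max_matching V ?N" using m N by (simp add: max_matching_def)
      moreover have "t \<notin> \<Union>?N" using N x f by auto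
      ultimately have "card (M \<inter> ?N) \<le> card (M \<inter> N)" using Nmax P_def by simp
      moreover have "M \<inter> ?N = insert {x, y} (M \<inter> N)" using e y fM by auto
      moreover have "card (insert {x, y} (M \<inter> N)) = Suc (card (M \<inter> N))" using nin finM by simp
      ultimately show False by simp
    qed
  qed
qed

text \<open>Induction on the order of \<open>V\<close>. A vertex covered by all maximum matchings is
  deleted and joins \<open>U\<close>. If there is none, the exchange argument puts the uncovered
  vertices into different components, and these components form the family, with \<open>U\<close>
  empty.\<close>

lemma Tutte_Berge:
  assumes "finite V"
  shows "\<exists>M U \<C>. matching V M \<and> odd_family V U \<C> \<and> card (V - \<Union>M) + card U \<le> card \<C>"
  using assms
proof (induction "card V" arbitrary: V rule: less_induct)
  case less
  note V = less.prems
  obtain M where M: "max_matching V M" using ex_max_matching[OF V] by blast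
  then have mM: "matching V M" by (simp add: max_matching_def)
  have missed_card: "card (W - \<Union>N) + 2 * card N = card W" if "matching W N" "finite W" for W N
  proof -
    have "\<Union>N \<subseteq> W" using that by (simp add: matching_def)
    then have "card (W - \<Union>N) + card (\<Union>N) = card W"
      using that(2) by (metis card_Diff_subset card_mono finite_subset le_add_diff_inverse2)
    then show ?thesis using card_Union_matching[OF that(1)] by simp
  qed
  show ?case
  proof (cases "\<exists>v\<in>V. \<forall>N. max_matching V N \<longrightarrow> v \<in> \<Union>N")
    case True
    then obtain v where v: "v \<in> V" "\<And>N. max_matching V N \<Longrightarrow> v \<in> \<Union>N" by blast
    have cV: "card V = Suc (card (V - {v}))" using V v by (metis card_Suc_Diff1)
    obtain M' U \<C> where M': "matching (V - {v}) M'" and oc: "odd_family (V - {v}) U \<C>"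
      and c: "card (V - {v} - \<Union>M') + card U \<le> card \<C>"
      using less.hyps[of "V - {v}"] cV V by auto
    have mM': "matching V M'" using M' by (auto simp: matching_def)
    \<comment> \<open>\<open>M'\<close> misses \<open>v\<close>, so \<open>M\<close> has at least
      one edge more. Hence \<open>M\<close> leaves fewer vertices of \<open>V\<close> uncovered than
      \<open>M'\<close> leaves in \<open>V - {v}\<close>, which pays for adding \<open>v\<close> to
      \<open>U\<close>.\<close>
    have "\<not> max_matching V M'" using v(2)[of M'] M' by (auto simp: matching_def)
    then have "card M' < card M" using M mM'
      unfolding max_matching_def by (meson le_trans not_le_imp_less)
    then have "card (V - \<Union>M) + 1 \<le> card (V - {v} - \<Union>M')"
      using missed_card[OF mM V] missed_card[OF M'] V cV by simp
    moreover have "card (insert v U) \<le> card U + 1"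
      by (metis Suc_eq_plus1 card.infinite card_insert_if finite_insert le_SucI order_refl le_add2)
    moreover have "odd_family V (insert v U) \<C>"
      using oc v(1) unfolding odd_family_def by blast
    ultimately show ?thesis using mM c by (intro exI[of _ M] exI[of _ "insert v U"] exI[of _ \<C>]) simp
  next
    case False
    then have missed: "\<And>x. x \<in> V \<Longrightarrow> \<exists>N. max_matching V N \<and> x \<notin> \<Union>N" by blast
    define R where "R = (adj V)\<^sup>*"
    define K where "K x = {y. (x, y) \<in> R}" for x
    have symR: "sym R" unfolding R_def
      by (intro sym_rtrancl) (auto simp: sym_def adj_def insert_commute)
    have trR: "trans R" unfolding R_def by (rule trans_rtrancl)
    have sep: "(u, v) \<notin> R" if "u \<in> V - \<Union>M" "v \<in> V - \<Union>M" "u \<noteq> v" for u v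
      using uncovered_not_connected[OF V missed M that] unfolding R_def by (auto simp: rtrancl_power)
    have KV: "K x \<subseteq> V" if "x \<in> V" for x
    proof
      fix y assume "y \<in> K x"
      then have "(x, y) \<in> (adj V)\<^sup>*" by (simp add: K_def R_def)
      then show "y \<in> V" using that by (induction) (auto simp: adj_def)
    qed
    have closed: "z \<in> K x" if "y \<in> K x" "{y, z} \<in> E" "z \<in> V" "x \<in> V" for x y z
    proof -
      have "(y, z) \<in> adj V" using that KV[of x] by (auto simp: adj_def)
      then show ?thesis using that(1) unfolding K_def R_def by (auto intro: rtrancl_into_rtrancl)
    qed
    \<comment> \<open>\<open>M\<close> covers every vertex of the component except \<open>x\<close>,
      and an edge of \<open>M\<close> that meets the component lies within it.\<close>
    have odd: "odd (card (K x))" if x: "x \<in> V - \<Union>M" for x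
    proof -
      let ?M = "{e \<in> M. e \<subseteq> K x}"
      have m: "matching V ?M" using mM by (auto simp: matching_def pairwise_def)
      have "K x = insert x (\<Union>?M)"
      proof
        show "K x \<subseteq> insert x (\<Union>?M)"
        proof
          fix y assume y: "y \<in> K x"
          show "y \<in> insert x (\<Union>?M)"
          proof (cases "y = x")
            case False
            have "y \<in> \<Union>M" using sep[of x y] x y KV[of x] False by (auto simp: K_def)
            then obtain e where e: "e \<in> M" "y \<in> e" by blast
            have eE: "e \<in> E" "e \<subseteq> V" using e mM by (auto simp: matching_def)
            obtain z where "e = {y, z}" using edge_other[OF eE(1) e(2)] .
            then have "e \<subseteq> K x" using closed[OF y, of z] eE x y by auto
            then show ?thesis using e by blast
          qed simp
        qed
      qed (auto simp: K_def R_def)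
      moreover have "finite (\<Union>?M)" using m V finite_subset by (auto simp: matching_def)
      moreover have "x \<notin> \<Union>?M" using x by blast
      ultimately have "card (K x) = Suc (2 * card ?M)"
        using card_Union_matching[OF m] by (metis card_insert_disjoint)
      then show ?thesis by simp
    qed
    have inj: "inj_on K (V - \<Union>M)"
    proof (rule inj_onI)
      fix x y assume xy: "x \<in> V - \<Union>M" "y \<in> V - \<Union>M" "K x = K y"
      have "y \<in> K y" by (simp add: K_def R_def)
      then have "(x, y) \<in> R" using xy(3) by (auto simp: K_def)
      then show "x = y" using sep xy by blast
    qed
    have disj: "pairwise disjnt (K ` (V - \<Union>M))"
    proof (rule pairwiseI)
      fix A B assume "A \<in> K ` (V - \<Union>M)" "B \<in> K ` (V - \<Union>M)" "A \<noteq> B"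
      then obtain x y where xy: "x \<in> V - \<Union>M" "y \<in> V - \<Union>M" "A = K x" "B = K y" "x \<noteq> y" by blast
      have False if "z \<in> K x" "z \<in> K y" for z
      proof -
        have "(x, z) \<in> R" "(z, y) \<in> R" using that symR by (auto simp: K_def sym_def)
        then show False using trR sep xy by (meson transD)
      qed
      then show "disjnt A B" using xy by (auto simp: disjnt_def)
    qed
    have "odd_family V {} (K ` (V - \<Union>M))"
      unfolding odd_family_def using odd disj closed KV by blast
    moreover have "card (K ` (V - \<Union>M)) = card (V - \<Union>M)" using inj card_image by blast
    ultimately show ?thesis using mM by (intro exI[of _ M] exI[of _ "{}"] exI[of _ "K ` (V - \<Union>M)"]) simp
  qed
qed

section \<open>Barriers: odd families with more members than the deleted set has vertices\<close>

lemma odd_familyI: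
  assumes "U \<subseteq> V" "\<Union>\<C> \<subseteq> V - U" "pairwise disjnt \<C>" "\<And>C. C \<in> \<C> \<Longrightarrow> odd (card C)"
    "\<And>C x y. C \<in> \<C> \<Longrightarrow> x \<in> C \<Longrightarrow> y \<in> V - U \<Longrightarrow> {x, y} \<in> E \<Longrightarrow> y \<in> C"
  shows "odd_family V U \<C>"
  using assms unfolding odd_family_def by blast

lemma odd_familyD:
  assumes "odd_family V U \<C>"
  shows "U \<subseteq> V" "\<Union>\<C> \<subseteq> V - U" "pairwise disjnt \<C>" "\<And>C. C \<in> \<C> \<Longrightarrow> odd (card C)"
    "\<And>C. C \<in> \<C> \<Longrightarrow> finite C"
    "\<And>C x y. C \<in> \<C> \<Longrightarrow> x \<in> C \<Longrightarrow> y \<in> V - U \<Longrightarrow> {x, y} \<in> E \<Longrightarrow> y \<in> C"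
proof -
  show "finite C" if "C \<in> \<C>" for C
  proof (rule ccontr)
    assume "infinite C"
    then have "card C = 0" by simp
    then show False using assms that by (auto simp: odd_family_def)
  qed
qed (use assms in \<open>unfold odd_family_def, blast+\<close>)

text \<open>The vertices that no member covers form a closed set \<open>W\<close>. If
  \<open>W\<close> has even order, one member absorbs it; otherwise it becomes a further member. The
  family does not shrink.\<close>

lemma odd_family_cover:
  assumes V: "finite V" and oc: "odd_family V U \<C>" and lt: "card U < card \<C>"
  shows "\<exists>\<C>'. odd_family V U \<C>' \<and> \<Union>\<C>' = V - U \<and> card U < card \<C>'"
proof -
  note oc = odd_familyD[OF oc]
  have finC: "finite \<C>" and ne: "\<C> \<noteq> {}" using lt by (auto intro: card_ge_0_finite)
  define W where "W = V - U - \<Union>\<C>"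
  have closedW: "y \<in> W" if "x \<in> W" and y: "y \<in> V - U" and "{x, y} \<in> E" for x y
  proof (rule ccontr)
    assume "y \<notin> W"
    then obtain C where "C \<in> \<C>" "y \<in> C" using y unfolding W_def by blast
    moreover have "x \<in> V - U" "{y, x} \<in> E" using that by (auto simp: W_def insert_commute)
    ultimately have "x \<in> C" using oc(6) by blast
    then show False using \<open>x \<in> W\<close> \<open>C \<in> \<C>\<close> unfolding W_def by blast
  qed
  have finW: "finite W" using V by (simp add: W_def)
  show ?thesis
  proof (cases "even (card W)")
    case True
    obtain C where C: "C \<in> \<C>" using ne by blast
    let ?C = "insert (C \<union> W) (\<C> - {C})"
    have CW: "C \<inter> W = {}" "W \<inter> \<Union>\<C> = {}" using C by (auto simp: W_def)
    have neC: "C \<noteq> {}" using oc(4)[OF C] by auto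
    have oddCW: "odd (card (C \<union> W))" using True oc(4)[OF C] CW finW oc(5)[OF C]
      by (simp add: card_Un_disjoint)
    have dj: "disjnt (C \<union> W) B" if "B \<in> \<C> - {C}" for B
    proof -
      have "disjnt C B" using pairwiseD[OF oc(3) C, of B] that by auto
      then show ?thesis using that CW unfolding disjnt_def by blast
    qed
    have un: "\<Union>?C = V - U" using C oc(2) by (auto simp: W_def)
    have "odd_family V U ?C"
    proof (rule odd_familyI)
      show "pairwise disjnt ?C"
        using dj by (intro pairwise_disjnt_insert pairwise_subset[OF oc(3)]) auto
      fix B assume B: "B \<in> ?C"
      show "odd (card B)" using B oddCW oc(4) by blast
      fix x y assume xy: "x \<in> B" "y \<in> V - U" "{x, y} \<in> E"
      show "y \<in> B"
      proof (cases "B = C \<union> W")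
        case True then show ?thesis using xy oc(6)[OF C, of x y] closedW[of x y] by blast
      next
        case False then show ?thesis using xy B oc(6)[of B x y] by blast
      qed
    qed (use oc(1) un in auto)
    moreover have "C \<union> W \<notin> \<C> - {C}"
    proof
      assume "C \<union> W \<in> \<C> - {C}"
      from dj[OF this] show False using neC by (auto simp: disjnt_def)
    qed
    then have "card ?C = Suc (card (\<C> - {C}))" using finC by (intro card_insert_disjoint) auto
    then have "card ?C = card \<C>" using card_Suc_Diff1[OF finC C] by simp
    ultimately show ?thesis using lt un by (intro exI[of _ ?C]) simp
  next
    case False
    let ?C = "insert W \<C>"
    have un: "\<Union>?C = V - U" using oc(2) by (auto simp: W_def)
    have "odd_family V U ?C"
    proof (rule odd_familyI)
      show "pairwise disjnt ?C"
        by (intro pairwise_disjnt_insert oc(3)) (auto simp: disjnt_def W_def)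
      fix B assume B: "B \<in> ?C"
      show "odd (card B)" using B False oc(4) by blast
      fix x y assume xy: "x \<in> B" "y \<in> V - U" "{x, y} \<in> E"
      show "y \<in> B"
      proof (cases "B = W")
        case True then show ?thesis using xy closedW[of x y] by blast
      next
        case False then show ?thesis using xy B oc(6)[of B x y] by blast
      qed
    qed (use oc(1) un in auto)
    moreover have "card \<C> \<le> card ?C" using finC by (simp add: card_insert_le)
    ultimately show ?thesis using lt un by (intro exI[of _ ?C]) simp
  qed
qed

text \<open>Returning \<open>u\<close> to the graph joins only \<open>C\<close> and
  \<open>C'\<close>, and odd + odd + 1 is odd. The set and the family each lose one element, so the
  strict inequality survives with a smaller set.\<close>

lemma odd_family_merge:
  assumes V: "finite V" and oc: "odd_family V U \<C>" and un: "\<Union>\<C> = V - U"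
    and lt: "card U < card \<C>" and u: "u \<in> U" and C: "C \<in> \<C>" "C' \<in> \<C>" "C \<noteq> C'"
    and nb: "\<And>w. w \<in> V - U \<Longrightarrow> {u, w} \<in> E \<Longrightarrow> w \<in> C \<union> C'"
  shows "\<exists>\<C>'. odd_family V (U - {u}) \<C>' \<and> \<Union>\<C>' = V - (U - {u}) \<and> card (U - {u}) < card \<C>'"
proof -
  note oc = odd_familyD[OF oc]
  have finU: "finite U" using V oc(1) finite_subset by blast
  have finC: "finite \<C>" using lt by (auto intro: card_ge_0_finite)
  let ?B = "insert u (C \<union> C')"
  let ?C = "insert ?B (\<C> - {C, C'})"
  have CC: "C \<inter> C' = {}" using pairwiseD[OF oc(3) C] by (simp add: disjnt_def)
  have uC: "u \<notin> C \<union> C'" using u C un by blast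
  have "card ?B = Suc (card C + card C')"
    using oc(5)[OF C(1)] oc(5)[OF C(2)] CC uC by (simp add: card_Un_disjoint)
  then have odd: "odd (card ?B)" using oc(4)[OF C(1)] oc(4)[OF C(2)] by simp
  have dj: "disjnt ?B A" if "A \<in> \<C> - {C, C'}" for A
  proof -
    have "disjnt C A" "disjnt C' A" "u \<notin> A"
      using pairwiseD[OF oc(3) C(1), of A] pairwiseD[OF oc(3) C(2), of A] that u un by auto
    then show ?thesis by (auto simp: disjnt_def)
  qed
  have un': "\<Union>?C = V - (U - {u})" using un u oc(1) C by blast
  have "odd_family V (U - {u}) ?C"
  proof (rule odd_familyI)
    show "pairwise disjnt ?C"
      using dj by (intro pairwise_disjnt_insert pairwise_subset[OF oc(3)]) auto
    fix A assume A: "A \<in> ?C"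
    show "odd (card A)" using A odd oc(4) by blast
    fix x y assume xy: "x \<in> A" "y \<in> V - (U - {u})" "{x, y} \<in> E"
    show "y \<in> A"
    proof (cases "A = ?B")
      case True
      show ?thesis
      proof (cases "y = u")
        case False
        then have "y \<in> V - U" using xy by blast
        then show ?thesis
          using True xy nb[of y] oc(6)[OF C(1), of x y] oc(6)[OF C(2), of x y] by blast
      qed (simp add: True)
    next
      case False
      then have A': "A \<in> \<C> - {C, C'}" using A by blast
      then have "x \<in> V - U" "x \<notin> C \<union> C'" using xy un dj[OF A'] by (auto simp: disjnt_def)
      then have "y \<noteq> u" using nb[of x] xy by (auto simp: insert_commute)
      then show ?thesis using oc(6)[of A x y] A' xy by blast
    qed
  qed (use un' odd oc(1) in auto)
  moreover have "card (U - {u}) < card ?C"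
  proof -
    have "?B \<notin> \<C> - {C, C'}" using un u by blast
    then have "card ?C = Suc (card (\<C> - {C, C'}))" using finC by (intro card_insert_disjoint) auto
    also have "card (\<C> - {C, C'}) = card \<C> - 2" using C finC by (simp add: card_Diff_subset)
    finally show ?thesis using lt u finU card_gt_0_iff[of U] by auto
  qed
  ultimately show ?thesis using un' by (intro exI[of _ ?C]) simp
qed

text \<open>The last clause is what minimality of \<open>U\<close> gives.\<close>

lemma Tutte_barrier:
  assumes V: "finite V" and no: "\<And>M. matching V M \<Longrightarrow> \<Union>M \<noteq> V"
  shows "\<exists>U \<C>. odd_family V U \<C> \<and> \<Union>\<C> = V - U \<and> card U < card \<C>
    \<and> (\<forall>u\<in>U. \<forall>C\<in>\<C>. \<forall>C'\<in>\<C>. C \<noteq> C' \<longrightarrow> (\<exists>w\<in>V - U - C - C'. {u, w} \<in> E))"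
proof -
  define P where "P U \<C> \<longleftrightarrow> odd_family V U \<C> \<and> \<Union>\<C> = V - U \<and> card U < card \<C>" for U \<C>
  have "\<exists>U \<C>. P U \<C>"
  proof -
    obtain M U \<C> where M: "matching V M" and oc: "odd_family V U \<C>"
      and c: "card (V - \<Union>M) + card U \<le> card \<C>" using Tutte_Berge[OF V] by blast
    have "V - \<Union>M \<noteq> {}" using no[OF M] M by (auto simp: matching_def)
    then have "card (V - \<Union>M) > 0" using V by (simp add: card_gt_0_iff)
    then show ?thesis using odd_family_cover[OF V oc] c unfolding P_def by auto
  qed
  then obtain U0 where "\<exists>\<C>. P U0 \<C>" by blast
  then obtain U where U: "\<exists>\<C>. P U \<C>" and Umin: "\<And>U'. \<exists>\<C>. P U' \<C> \<Longrightarrow> card U \<le> card U'"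
    using ex_has_least_nat[of "\<lambda>U. \<exists>\<C>. P U \<C>" U0 card] by blast
  then obtain \<C> where P: "P U \<C>" by blast
  then have oc: "odd_family V U \<C>" and un: "\<Union>\<C> = V - U" and lt: "card U < card \<C>"
    by (auto simp: P_def)
  have finU: "finite U" using V odd_familyD(1)[OF oc] finite_subset by blast
  have "\<exists>w\<in>V - U - C - C'. {u, w} \<in> E"
    if u: "u \<in> U" and C: "C \<in> \<C>" "C' \<in> \<C>" "C \<noteq> C'" for u C C'
  proof (rule ccontr)
    assume "\<not> ?thesis"
    then have nb: "w \<in> C \<union> C'" if "w \<in> V - U" "{u, w} \<in> E" for w using that by blast
    have "\<exists>\<C>'. P (U - {u}) \<C>'"
      using odd_family_merge[OF V oc un lt u C nb] unfolding P_def by blast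
    then have "card U \<le> card (U - {u})" using Umin by blast
    moreover have "card (U - {u}) < card U" using u finU by (rule card_Diff1_less[rotated])
    ultimately show False by simp
  qed
  then show ?thesis using oc un lt by blast
qed

end

subsection \<open>Darts\<close>

text \<open>A dart \<open>(e, c)\<close> is an edge with a chosen end. It lies at \<open>p (e, c)\<close>, and its edge leads to
  \<open>p (opp (e, c))\<close>.\<close>

fun opp :: "'e \<times> bool \<Rightarrow> 'e \<times> bool" where
  "opp (e, c) = (e, \<not> c)"

lemma opp_opp [simp]: "opp (opp d) = d" by (cases d) simp
lemma fst_opp [simp]: "fst (opp d) = fst d" by (cases d) simp
lemma opp_in_iff [simp]: "opp d \<in> E \<times> UNIV \<longleftrightarrow> d \<in> E \<times> UNIV" by (cases d) simp

lemma fst_eq_dart: "fst d = fst d' \<longleftrightarrow> d' = d \<or> d' = opp d"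
  by (cases d; cases d') auto

text \<open>Such a set consists of both darts of each of its edges.\<close>

lemma even_card_opp_closed:
  assumes "finite D" "\<And>d. d \<in> D \<Longrightarrow> opp d \<in> D" shows "even (card D)"
proof -
  have "D = fst ` D \<times> UNIV"
  proof
    show "fst ` D \<times> UNIV \<subseteq> D"
    proof
      fix d :: "'a \<times> bool" assume "d \<in> fst ` D \<times> UNIV"
      then obtain d' where "d' \<in> D" "fst d' = fst d" by auto
      then show "d \<in> D" using assms(2)[of d'] fst_eq_dart[of d' d] by auto
    qed
  qed force
  then have "card D = card (fst ` D) * 2" by (metis card_cartesian_product card_UNIV_bool)
  then show ?thesis by simp
qed

text \<open>An edge counts twice if both its ends lie in \<open>X \<inter> Y\<close>.\<close>

definition dcount :: "('e \<times> bool \<Rightarrow> 'v) \<Rightarrow> 'e set \<Rightarrow> 'v set \<Rightarrow> 'v set \<Rightarrow> nat" where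
  "dcount p E X Y = card {d \<in> E \<times> UNIV. p d \<in> X \<and> p (opp d) \<in> Y}"

text \<open>Both darts of a loop lie at the same vertex, so a loop counts twice, as in
  \<open>degree\<close>.\<close>

definition deg :: "('e \<times> bool \<Rightarrow> 'v) \<Rightarrow> 'e set \<Rightarrow> 'v \<Rightarrow> nat" where
  "deg p E x = card {d \<in> E \<times> UNIV. p d = x}"

locale dart_graph =
  fixes V :: "'v set" and E :: "'e set" and p :: "'e \<times> bool \<Rightarrow> 'v"
  assumes finite_V: "finite V" and finite_E: "finite E"
    and p_in: "d \<in> E \<times> UNIV \<Longrightarrow> p d \<in> V"
begin

lemma finite_darts: "finite {d \<in> E \<times> (UNIV :: bool set). P d}"
  by (rule finite_subset[of _ "E \<times> UNIV"]) (use finite_E in auto)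

lemma dcount_sym: "dcount p E X Y = dcount p E Y X"
  unfolding dcount_def
  by (rule bij_betw_same_card[of opp], rule bij_betw_byWitness[of _ opp]) auto

lemma dcount_Un_left:
  "X \<inter> X' = {} \<Longrightarrow> dcount p E (X \<union> X') Y = dcount p E X Y + dcount p E X' Y"
  unfolding dcount_def
  by (subst card_Un_disjoint[symmetric]) (auto intro!: finite_darts arg_cong[where f = card])

lemma dcount_Un_right:
  "Y \<inter> Y' = {} \<Longrightarrow> dcount p E X (Y \<union> Y') = dcount p E X Y + dcount p E X Y'"
  by (metis dcount_Un_left dcount_sym)

lemma dcount_mono: "X \<subseteq> X' \<Longrightarrow> Y \<subseteq> Y' \<Longrightarrow> dcount p E X Y \<le> dcount p E X' Y'"
  unfolding dcount_def by (intro card_mono finite_darts) auto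

lemma dcount_Union_left:
  assumes "finite \<K>" "pairwise disjnt \<K>"
  shows "dcount p E (\<Union>\<K>) Y = (\<Sum>K\<in>\<K>. dcount p E K Y)"
  using assms
proof (induction)
  case empty show ?case by (simp add: dcount_def)
next
  case (insert K \<K>)
  have "K \<inter> \<Union>\<K> = {}" using insert.hyps insert.prems by (auto simp: pairwise_insert disjnt_def)
  then show ?case using insert dcount_Un_left[of K "\<Union>\<K>"] by (simp add: pairwise_insert)
qed

lemma dcount_V: "finite X \<Longrightarrow> dcount p E X V = (\<Sum>x\<in>X. deg p E x)"
proof -
  assume "finite X"
  have "{d \<in> E \<times> UNIV. p d \<in> X \<and> p (opp d) \<in> V} = (\<Union>x\<in>X. {d \<in> E \<times> UNIV. p d = x})"
    using p_in by auto
  then show ?thesis unfolding dcount_def deg_def using \<open>finite X\<close>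
    by (simp only:) (rule card_UN_disjoint, auto intro: finite_darts)
qed

lemma even_dcount_self: "even (dcount p E X X)"
  unfolding dcount_def by (intro even_card_opp_closed finite_darts) auto

lemma sum_deg: "(\<Sum>x\<in>V. deg p E x) = 2 * card E"
proof -
  have "(\<Sum>x\<in>V. deg p E x) = dcount p E V V" using dcount_V finite_V by simp
  also have "{d \<in> E \<times> UNIV. p d \<in> V \<and> p (opp d) \<in> V} = E \<times> UNIV" using p_in by auto
  then have "dcount p E V V = 2 * card E" by (simp add: dcount_def card_cartesian_product)
  finally show ?thesis .
qed

end

subsection \<open>The factor theorem\<close>

text \<open>Tutte's gadget: a dart becomes a vertex joined to its opposite, and the darts at \<open>x\<close> are
  completely joined to \<open>deg x - f x\<close> new vertices, which absorb the darts at \<open>x\<close> not used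
  by an \<open>f\<close>-factor.\<close>

locale factor_gadget = dart_graph V E p
  for V :: "'v set" and E :: "'e set" and p :: "'e \<times> bool \<Rightarrow> 'v" +
  fixes f :: "'v \<Rightarrow> nat"
  assumes f_le: "x \<in> V \<Longrightarrow> f x \<le> deg p E x"
begin

definition cores :: "'v \<Rightarrow> (('e \<times> bool) + ('v \<times> nat)) set" where
  "cores x = (\<lambda>i. Inr (x, i)) ` {..<deg p E x - f x}"

definition darts_at :: "'v \<Rightarrow> (('e \<times> bool) + ('v \<times> nat)) set" where
  "darts_at x = Inl ` {d \<in> E \<times> UNIV. p d = x}"

definition W :: "(('e \<times> bool) + ('v \<times> nat)) set" where
  "W = Inl ` (E \<times> UNIV) \<union> (\<Union>x\<in>V. cores x)"

definition \<E> :: "(('e \<times> bool) + ('v \<times> nat)) set set" where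
  "\<E> = {{Inl d, Inl (opp d)} | d. d \<in> E \<times> UNIV}
     \<union> {{Inl d, c} | d c. d \<in> E \<times> UNIV \<and> c \<in> cores (p d)}"

lemma cores_disjoint: "c \<in> cores x \<Longrightarrow> c \<in> cores y \<Longrightarrow> x = y"
  by (auto simp: cores_def)

lemma Inl_notin_cores [simp]: "Inl d \<notin> cores x"
  by (auto simp: cores_def)

sublocale simple_graph \<E>
proof
  fix e assume "e \<in> \<E>"
  then show "card e = 2" unfolding \<E>_def by (auto simp: cores_def card_2_iff)
qed

lemma card_cores: "card (cores x) = deg p E x - f x"
  unfolding cores_def by (subst card_image) (auto simp: inj_on_def)

lemma finite_cores: "finite (cores x)"
  by (simp add: cores_def)

lemma card_darts_at: "card (darts_at x) = deg p E x"
  unfolding darts_at_def deg_def by (rule card_image) (auto simp: inj_on_def)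

lemma finite_darts_at: "finite (darts_at x)"
  unfolding darts_at_def by (intro finite_imageI finite_darts)

lemma finite_W: "finite W"
  unfolding W_def using finite_E finite_V finite_cores by auto

lemma edge_darts: "{Inl d, Inl d'} \<in> \<E> \<longleftrightarrow> d \<in> E \<times> UNIV \<and> d' = opp d"
proof
  assume "{Inl d, Inl d'} \<in> \<E>" (is "?e \<in> _")
  then consider d0 where "d0 \<in> E \<times> UNIV" "?e = {Inl d0, Inl (opp d0)}"
    | d0 c where "c \<in> cores (p d0)" "?e = {Inl d0, c}"
    unfolding \<E>_def by blast
  then show "d \<in> E \<times> UNIV \<and> d' = opp d"
  proof cases
    case (1 d0)
    then consider "d = d0" "d' = opp d0" | "d = opp d0" "d' = d0" by (auto simp: doubleton_eq_iff)
    then show ?thesis using 1(1) by cases (simp_all del: mem_Sigma_iff)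
  next
    case (2 d0 c)
    then have "c \<in> ?e" by simp
    then show ?thesis using 2(1) by auto
  qed
next
  assume "d \<in> E \<times> UNIV \<and> d' = opp d"
  then show "{Inl d, Inl d'} \<in> \<E>" unfolding \<E>_def by blast
qed

lemma edge_core: "c \<in> cores x \<Longrightarrow> {Inl d, c} \<in> \<E> \<longleftrightarrow> d \<in> E \<times> UNIV \<and> p d = x"
  unfolding \<E>_def by (auto simp: doubleton_eq_iff cores_def)

lemma core_nbr: "{c, w} \<in> \<E> \<Longrightarrow> c \<in> cores x \<Longrightarrow> w \<in> darts_at x"
  unfolding \<E>_def by (auto simp: doubleton_eq_iff cores_def darts_at_def)

lemma dart_nbr: "{Inl d, w} \<in> \<E> \<Longrightarrow> w = Inl (opp d) \<or> w \<in> cores (p d)"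
  unfolding \<E>_def by (auto simp: doubleton_eq_iff)

text \<open>The factor consists of the edges whose two darts are matched to each other. Every other
  dart at \<open>x\<close> is matched to a core at \<open>x\<close>, and every core at
  \<open>x\<close> to such a dart, so exactly \<open>f x\<close> darts at \<open>x\<close> remain
  for the factor.\<close>

lemma perfect_matching_factor:
  assumes M: "matching W M" and perf: "\<Union>M = W"
  shows "\<exists>F\<subseteq>E. \<forall>x\<in>V. deg p F x = f x"
proof -
  define F where "F = {e \<in> E. {Inl (e, True), Inl (e, False)} \<in> M}"
  have F_iff: "fst d \<in> F \<longleftrightarrow> {Inl d, Inl (opp d)} \<in> M" if "d \<in> E \<times> UNIV" for d
    using that unfolding F_def by (cases d; cases "snd d") (auto simp: insert_commute)
  have ME: "M \<subseteq> \<E>" using M by (simp add: matching_def)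
  have "deg p F x = f x" if x: "x \<in> V" for x
  proof -
    let ?A = "{d \<in> E \<times> UNIV. p d = x}" and ?B = "{d \<in> F \<times> UNIV. p d = x}"
    have fin: "finite (?A - ?B)" by (intro finite_Diff finite_darts)
    have BA: "?B \<subseteq> ?A" by (auto simp: F_def)
    let ?r = "\<lambda>d c. {Inl d, c} \<in> M"
    have "card (?A - ?B) \<le> card (cores x)"
    proof (rule card_le_if_inj_on_rel[where r = ?r])
      fix d assume d: "d \<in> ?A - ?B"
      then have "Inl d \<in> \<Union>M" unfolding perf W_def by auto
      then obtain e where e: "e \<in> M" "Inl d \<in> e" by blast
      then obtain w where w: "e = {Inl d, w}" using edge_other ME by blast
      have "w \<noteq> Inl (opp d)" using w e F_iff[of d] d by auto
      then have "w \<in> cores x" using dart_nbr[of d w] w e ME d by auto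
      then show "\<exists>c. c \<in> cores x \<and> ?r d c" using w e by blast
    next
      fix d d' c assume *: "c \<in> cores x" "?r d c" "?r d' c"
      then have "{Inl d, c} = {Inl d', c}" using matching_unique[OF M, of _ _ c] by blast
      then show "d = d'" using * by (auto simp: doubleton_eq_iff)
    qed (rule finite_cores)
    moreover have "card (cores x) \<le> card (?A - ?B)"
    proof (rule card_le_if_inj_on_rel[where r = "\<lambda>c d. ?r d c"])
      fix c assume c: "c \<in> cores x"
      then have "c \<in> \<Union>M" unfolding perf W_def using x by auto
      then obtain e where e: "e \<in> M" "c \<in> e" by blast
      then obtain w where w: "e = {c, w}" using edge_other ME by blast
      then have "w \<in> darts_at x" using core_nbr[OF _ c] e ME by blast
      then obtain d where d: "w = Inl d" "d \<in> ?A" by (auto simp: darts_at_def)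
      have "fst d \<notin> F"
      proof
        assume "fst d \<in> F"
        then have "{Inl d, Inl (opp d)} \<in> M" using F_iff d by blast
        then have "{Inl d, Inl (opp d)} = e"
          using matching_unique[OF M _ e(1), of _ "Inl d"] w d by blast
        then show False using w c by (auto simp: doubleton_eq_iff)
      qed
      then have "d \<in> ?A - ?B" using d by auto
      moreover have "?r d c" using d w e by (simp add: insert_commute)
      ultimately show "\<exists>d. d \<in> ?A - ?B \<and> ?r d c" by blast
    next
      fix c c' d assume *: "c \<in> cores x" "c' \<in> cores x" "?r d c" "?r d c'"
      then have "{Inl d, c} = {Inl d, c'}" using matching_unique[OF M, of _ _ "Inl d"] by blast
      then show "c = c'" using * by (auto simp: doubleton_eq_iff)
    qed (rule fin)
    ultimately have "card (?A - ?B) = deg p E x - f x" by (simp add: card_cores)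
    moreover have "card (?A - ?B) + card ?B = card ?A"
    proof -
      have "finite ?A" by (rule finite_darts)
      then show ?thesis
        using BA card_Diff_subset[OF finite_subset[OF BA] BA] card_mono[OF _ BA] by simp
    qed
    ultimately show ?thesis using f_le[OF x] unfolding deg_def by simp
  qed
  moreover have "F \<subseteq> E" by (auto simp: F_def)
  ultimately show ?thesis by (intro exI[of _ F]) simp
qed

text \<open>For parity: the gadget graph has even order when the sum of \<open>f\<close> is
  even.\<close>

lemma card_W: "card W + (\<Sum>x\<in>V. f x) = 4 * card E"
proof -
  have "card W = card (Inl ` (E \<times> UNIV) :: (('e \<times> bool) + ('v \<times> nat)) set) + card (\<Union>x\<in>V. cores x)"
    unfolding W_def using finite_E finite_V finite_cores by (intro card_Un_disjoint) auto
  also have "card (Inl ` (E \<times> UNIV) :: (('e \<times> bool) + ('v \<times> nat)) set) = 2 * card E"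
    by (subst card_image) (auto simp: card_cartesian_product)
  also have "card (\<Union>x\<in>V. cores x) = (\<Sum>x\<in>V. deg p E x - f x)"
    using finite_V finite_cores cores_disjoint by (subst card_UN_disjoint) (auto simp: card_cores)
  finally have "card W + (\<Sum>x\<in>V. f x) = 2 * card E + (\<Sum>x\<in>V. (deg p E x - f x) + f x)"
    by (simp add: sum.distrib)
  also have "(\<Sum>x\<in>V. (deg p E x - f x) + f x) = (\<Sum>x\<in>V. deg p E x)"
    using f_le by (intro sum.cong) auto
  finally show ?thesis using sum_deg by simp
qed

section \<open>From a barrier of the gadget graph to the sets \<open>S\<close>, \<open>T\<close> and
  \<open>\<K>\<close>\<close>

lemma dart_at: "d \<in> E \<times> UNIV \<Longrightarrow> Inl d \<in> darts_at (p d)"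
  unfolding darts_at_def by blast

lemma darts_at_disjoint: "w \<in> darts_at x \<Longrightarrow> w \<in> darts_at y \<Longrightarrow> x = y"
  by (auto simp: darts_at_def)

lemma cores_darts_at: "cores x \<inter> darts_at y = {}"
  by (auto simp: darts_at_def)

text \<open>The sufficiency half of Tutte's \<open>f\<close>-factor theorem.\<close>

lemma factor_barrier:
  assumes no: "\<not> (\<exists>F\<subseteq>E. \<forall>x\<in>V. deg p F x = f x)" and ev: "even (\<Sum>x\<in>V. f x)"
  shows "\<exists>S T \<K>. S \<subseteq> V \<and> T \<subseteq> V \<and> S \<inter> T = {} \<and> finite \<K> \<and> pairwise disjnt \<K> \<and> \<Union>\<K> \<subseteq> V - S - T
    \<and> (\<forall>K\<in>\<K>. dcount p E K (V - S - T - K) = 0 \<and> odd ((\<Sum>x\<in>K. f x) + dcount p E K T))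
    \<and> (\<Sum>x\<in>S. f x) + dcount p E T (V - S) + 2 \<le> (\<Sum>x\<in>T. f x) + card \<K>"
proof -
  have "\<Union>M \<noteq> W" if "matching W M" for M using perfect_matching_factor[OF that] no by blast
  then obtain U \<C> where oc: "odd_family W U \<C>" and un: "\<Union>\<C> = W - U" and lt: "card U < card \<C>"
    and adjU: "\<And>u C C'. u \<in> U \<Longrightarrow> C \<in> \<C> \<Longrightarrow> C' \<in> \<C> \<Longrightarrow> C \<noteq> C' \<Longrightarrow> \<exists>w\<in>W - U - C - C'. {u, w} \<in> \<E>"
    using Tutte_barrier[OF finite_W] by metis
  note oc = odd_familyD[OF oc]
  have finC: "finite \<C>" using lt by (auto intro: card_ge_0_finite)
  have finU: "finite U" using oc(1) finite_W finite_subset by blast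
  have uniq: "C = C'" if "C \<in> \<C>" "C' \<in> \<C>" "w \<in> C" "w \<in> C'" for C C' w
    using pairwiseD[OF oc(3), of C C'] that by (auto simp: disjnt_def)
  have another: "\<exists>C'\<in>\<C>. C' \<noteq> C" if "u \<in> U" for u C
  proof (rule ccontr)
    assume "\<not> ?thesis"
    then have "\<C> \<subseteq> {C}" by blast
    then have "card \<C> \<le> 1" using card_mono[of "{C}" \<C>] by simp
    moreover have "card U > 0" using that finU by (auto simp: card_gt_0_iff)
    ultimately show False using lt by simp
  qed
  \<comment> \<open>A neighbour of \<open>u\<close> outside \<open>C\<close> that also avoids a
    prescribed \<open>y\<close>: the barrier excludes two members at once, so the member containing
    \<open>y\<close> is taken as the second one if there is one other than \<open>C\<close>.\<close>
  have nbr: "\<exists>z\<in>W - U - C. {u, z} \<in> \<E> \<and> z \<noteq> y" if uC: "u \<in> U" "C \<in> \<C>" for u C y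
  proof (cases "\<exists>C'\<in>\<C>. C' \<noteq> C \<and> y \<in> C'")
    case True
    then obtain C' where "C' \<in> \<C>" "C' \<noteq> C" "y \<in> C'" by blast
    then show ?thesis using adjU[OF uC, of C'] by blast
  next
    case False
    obtain C' where "C' \<in> \<C>" "C' \<noteq> C" using another \<open>u \<in> U\<close> by blast
    then obtain z where z: "z \<in> W - U - C" "{u, z} \<in> \<E>" using adjU[OF uC, of C'] by blast
    then have "z \<in> \<Union>\<C>" using un by blast
    then have "z \<noteq> y" using False z by blast
    then show ?thesis using z by blast
  qed
  have in_W: "darts_at x \<subseteq> W" "cores x \<subseteq> W" if "x \<in> V" for x
    using that unfolding W_def darts_at_def by auto

  \<comment> \<open>By minimality, \<open>U\<close> contains all or none of the cores at a vertex, and all or none of the darts.\<close>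
  define T where "T = {x \<in> V. cores x \<subseteq> U}"
  define S where "S = {x \<in> V - T. darts_at x \<subseteq> U}"
  have TS: "T \<subseteq> V" "S \<subseteq> V" "S \<inter> T = {}" by (auto simp: T_def S_def)
  then have finTS: "finite T" "finite S" using finite_V finite_subset by blast+

  \<comment> \<open>All cores at \<open>x\<close> have the same neighbours. If \<open>w\<close> lies
    in the member \<open>C\<close>, then so do all its neighbours outside \<open>U\<close>, which
    leaves \<open>u\<close> without a neighbour outside \<open>U\<close> and
    \<open>C\<close>.\<close>
  have coreU: "cores x \<inter> U = {}" if x: "x \<in> V" "x \<notin> T" for x
  proof (rule ccontr)
    assume "cores x \<inter> U \<noteq> {}"
    then obtain u where u: "u \<in> cores x" "u \<in> U" by blast
    obtain w where w: "w \<in> cores x" "w \<notin> U" using x by (auto simp: T_def)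
    then have "w \<in> \<Union>\<C>" using un in_W x by blast
    then obtain C where C: "C \<in> \<C>" "w \<in> C" by blast
    obtain z where z: "z \<in> W - U - C" "{u, z} \<in> \<E>" using nbr[OF u(2) C(1)] by blast
    obtain d where d: "z = Inl d" "d \<in> E \<times> UNIV" "p d = x"
      using core_nbr[OF z(2) u(1)] by (auto simp: darts_at_def)
    have "{w, z} \<in> \<E>" using edge_core[OF w(1), of d] d by (simp add: insert_commute)
    then show False using oc(6)[OF C] z by blast
  qed
  \<comment> \<open>The cores at a vertex of \<open>T\<close> lie in \<open>U\<close>, so only the
    opposite dart could be a neighbour outside \<open>U\<close>, and \<open>nbr\<close> provides one
    different from it.\<close>
  have dartT: "Inl d \<notin> U" if d: "d \<in> E \<times> UNIV" "p d \<in> T" for d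
  proof
    assume u: "Inl d \<in> U"
    obtain C where C: "C \<in> \<C>" using another[OF u] by blast
    obtain z where "z \<in> W - U - C" "{Inl d, z} \<in> \<E>" "z \<noteq> Inl (opp d)" using nbr[OF u C] by blast
    then show False using dart_nbr[of d z] d by (auto simp: T_def)
  qed
  \<comment> \<open>The whole gadget of a vertex outside \<open>S\<close> and \<open>T\<close> lies
    in one member: a dart outside \<open>U\<close> draws all cores into its member \<open>C\<close>,
    after which no dart there can be in \<open>U\<close> by \<open>nbr\<close>, and the cores draw
    the darts into \<open>C\<close>.\<close>
  have blob: "\<exists>C\<in>\<C>. cores x \<union> darts_at x \<subseteq> C" "cores x \<noteq> {}" if x: "x \<in> V - S - T" for x
  proof -
    show ne: "cores x \<noteq> {}" using x by (auto simp: T_def)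
    have cU: "cores x \<inter> U = {}" using coreU x by blast
    obtain d0 where d0: "d0 \<in> E \<times> UNIV" "p d0 = x" "Inl d0 \<notin> U"
      using x by (auto simp: S_def darts_at_def)
    then have "Inl d0 \<in> \<Union>\<C>" using un by (auto simp: W_def)
    then obtain C where C: "C \<in> \<C>" "Inl d0 \<in> C" by blast
    have cC: "cores x \<subseteq> C"
    proof
      fix c assume c: "c \<in> cores x"
      then have "c \<in> W - U" using cU in_W x by blast
      then show "c \<in> C" using oc(6)[OF C, of c] edge_core[OF c, of d0] d0 by blast
    qed
    have "Inl d \<in> C" if d: "d \<in> E \<times> UNIV" "p d = x" for d
    proof -
      have "Inl d \<notin> U"
      proof
        assume u: "Inl d \<in> U"
        obtain z where z: "z \<in> W - U - C" "{Inl d, z} \<in> \<E>" "z \<noteq> Inl (opp d)" using nbr[OF u C(1)] by blast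
        then show False using dart_nbr[of d z] d cC by auto
      qed
      then have "Inl d \<in> W - U" using d by (auto simp: W_def)
      moreover obtain c where "c \<in> cores x" using ne by blast
      moreover have "{c, Inl d} \<in> \<E>" using edge_core[of c x d] d \<open>c \<in> cores x\<close> by (simp add: insert_commute)
      ultimately show ?thesis using oc(6)[OF C(1), of c] cC by blast
    qed
    then have "cores x \<union> darts_at x \<subseteq> C" using cC by (auto simp: darts_at_def)
    then show "\<exists>C\<in>\<C>. cores x \<union> darts_at x \<subseteq> C" using C by blast
  qed
  have dart_opp: "Inl (opp d) \<in> C" if "C \<in> \<C>" "Inl d \<in> C" "d \<in> E \<times> UNIV" "Inl (opp d) \<notin> U" for C d
  proof -
    have "Inl (opp d) \<in> W - U" using that by (auto simp: W_def)
    moreover have "{Inl d, Inl (opp d)} \<in> \<E>" using that edge_darts by blast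
    ultimately show ?thesis using oc(6)[OF that(1,2)] by blast
  qed

  \<comment> \<open>The elements of \<open>Z\<close> have all their neighbours in \<open>U\<close>.
    At most \<open>card Z\<close> members meet \<open>Z\<close>; the remaining ones, in
    \<open>\<C>\<^sub>2\<close>, yield the sets \<open>K\<close>.\<close>
  define Z :: "(('e \<times> bool) + ('v \<times> nat)) set" where "Z = (\<Union>x\<in>S. cores x) \<union> Inl ` {d \<in> E \<times> UNIV. p d \<in> T \<and> p (opp d) \<in> S}"
  define \<C>\<^sub>1 where "\<C>\<^sub>1 = {C \<in> \<C>. C \<inter> Z \<noteq> {}}"
  define \<C>\<^sub>2 where "\<C>\<^sub>2 = \<C> - \<C>\<^sub>1"
  \<comment> \<open>The vertices outside \<open>S\<close> and \<open>T\<close> whose gadget lies in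
    \<open>C\<close>; by \<open>blob\<close> meeting the cores is the same as containing the
    gadget.\<close>
  define X where "X C = {x \<in> V - S - T. cores x \<inter> C \<noteq> {}}" for C
  have finZ: "finite Z" unfolding Z_def using finTS finite_cores finite_darts by auto
  have cardZ: "card Z \<le> (\<Sum>x\<in>S. deg p E x - f x) + dcount p E T S"
  proof -
    have "card Z \<le> card (\<Union>x\<in>S. cores x) + card (Inl ` {d \<in> E \<times> UNIV. p d \<in> T \<and> p (opp d) \<in> S} :: (('e \<times> bool) + ('v \<times> nat)) set)"
      unfolding Z_def by (rule card_Un_le)
    moreover have "card (\<Union>x\<in>S. cores x) \<le> (\<Sum>x\<in>S. deg p E x - f x)"
      using card_UN_le[OF finTS(2), of cores] by (simp add: card_cores)
    moreover have "card (Inl ` {d \<in> E \<times> UNIV. p d \<in> T \<and> p (opp d) \<in> S} :: (('e \<times> bool) + ('v \<times> nat)) set) \<le> dcount p E T S"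
      unfolding dcount_def by (intro card_image_le finite_darts)
    ultimately show ?thesis by simp
  qed
  have cardC1: "card \<C>\<^sub>1 \<le> card Z"
  proof (rule card_le_if_inj_on_rel[where r = "\<lambda>C z. z \<in> C"])
    show "\<exists>z. z \<in> Z \<and> z \<in> C" if "C \<in> \<C>\<^sub>1" for C using that by (auto simp: \<C>\<^sub>1_def)
    show "C = C'" if "C \<in> \<C>\<^sub>1" "C' \<in> \<C>\<^sub>1" "z \<in> C" "z \<in> C'" for C C' z
      using uniq that by (auto simp: \<C>\<^sub>1_def)
  qed (rule finZ)
  have XC: "cores x \<union> darts_at x \<subseteq> C" if xC: "C \<in> \<C>" "x \<in> X C" for x C
  proof -
    obtain C' where C': "C' \<in> \<C>" "cores x \<union> darts_at x \<subseteq> C'" using blob(1)[of x] xC by (auto simp: X_def)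
    then have "C' = C" using xC uniq[OF C'(1) xC(1)] by (auto simp: X_def)
    then show ?thesis using C' by simp
  qed
  have XI: "x \<in> X C" if xC: "C \<in> \<C>" "x \<in> V - S - T" "w \<in> cores x \<union> darts_at x" "w \<in> C" for x w C
  proof -
    obtain C' where C': "C' \<in> \<C>" "cores x \<union> darts_at x \<subseteq> C'" using blob(1)[of x] xC by blast
    then have "C' = C" using that uniq by blast
    then show ?thesis using C' that blob(2)[of x] by (auto simp: X_def)
  qed
  have Xuniq: "C = C'" if "C \<in> \<C>" "C' \<in> \<C>" "x \<in> X C" "x \<in> X C'" for C C' x
    using XC[of C x] XC[of C' x] uniq[of C C'] that by (auto simp: X_def)
  have nR: "Inl d \<notin> U" if d: "d \<in> E \<times> UNIV" "p d \<in> V - S - T" for d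
  proof -
    obtain C where "C \<in> \<C>" "cores (p d) \<union> darts_at (p d) \<subseteq> C" using blob(1) d by blast
    then have "Inl d \<in> \<Union>\<C>" using dart_at[OF d(1)] by blast
    then show ?thesis using un by blast
  qed
  have Xclosed: "dcount p E (X C) (V - S - T - X C) = 0" if C: "C \<in> \<C>" for C
  proof -
    have False if d: "d \<in> E \<times> UNIV" "p d \<in> X C" "p (opp d) \<in> V - S - T - X C" for d
    proof -
      have od: "opp d \<in> E \<times> UNIV" using d(1) opp_in_iff by blast
      have "Inl d \<in> C" using XC[OF C d(2)] dart_at[OF d(1)] by blast
      then have "Inl (opp d) \<in> C" using dart_opp[OF C _ d(1)] d nR[OF od] by blast
      then show False using XI[OF C, of "p (opp d)" "Inl (opp d)"] d dart_at[OF od] by blast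
    qed
    then have "{d \<in> E \<times> UNIV. p d \<in> X C \<and> p (opp d) \<in> V - S - T - X C} = {}" by blast
    then show ?thesis unfolding dcount_def by (metis card.empty)
  qed
  \<comment> \<open>Count \<open>C\<close> modulo 2. A vertex \<open>x\<close> of \<open>X C\<close>
    contributes \<open>2 * deg p E x - f x\<close>. The darts at \<open>T\<close> in
    \<open>C\<close> are of two kinds: those of edges inside \<open>T\<close> come in opposite
    pairs, and those of edges to \<open>X C\<close> number
    \<open>dcount p E (X C) T\<close>.\<close>
  have Xodd: "odd ((\<Sum>x\<in>X C. f x) + dcount p E (X C) T)" if C2: "C \<in> \<C>\<^sub>2" for C
  proof -
    have C: "C \<in> \<C>" and CZ: "C \<inter> Z = {}" using C2 by (auto simp: \<C>\<^sub>2_def \<C>\<^sub>1_def)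
    have CW: "C \<subseteq> W - U" using un C by blast
    have finX: "finite (X C)" using finite_V by (auto simp: X_def)
    let ?B = "\<Union>x\<in>X C. cores x \<union> darts_at x"
    let ?T1 = "{d \<in> E \<times> UNIV. p d \<in> T \<and> p (opp d) \<in> T \<and> Inl d \<in> C}"
    let ?T2 = "{d \<in> E \<times> UNIV. p d \<in> T \<and> p (opp d) \<in> X C}"
    have nS: "p d \<notin> S" if "d \<in> E \<times> UNIV" "Inl d \<in> C" for d
      using that CW dart_at[of d] unfolding S_def by blast
    have eq: "C = ?B \<union> Inl ` (?T1 \<union> ?T2)"
    proof
      show "C \<subseteq> ?B \<union> Inl ` (?T1 \<union> ?T2)"
      proof
        fix w assume w: "w \<in> C"
        then have "w \<in> W" "w \<notin> U" using CW by auto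
        then consider d where "w = Inl d" "d \<in> E \<times> UNIV" | x where "x \<in> V" "w \<in> cores x"
          by (auto simp: W_def)
        then show "w \<in> ?B \<union> Inl ` (?T1 \<union> ?T2)"
        proof cases
          case (1 d)
          have od: "opp d \<in> E \<times> UNIV" using 1(2) opp_in_iff by blast
          have pV: "p d \<in> V" "p (opp d) \<in> V" using p_in[OF 1(2)] p_in[OF od] by blast+
          have dS: "p d \<notin> S" using nS 1 w by blast
          show ?thesis
          proof (cases "p d \<in> T")
            case True
            then have oS: "p (opp d) \<notin> S" using CZ w 1 True unfolding Z_def by blast
            show ?thesis
            proof (cases "p (opp d) \<in> T")
              case False
              then have "Inl (opp d) \<notin> U" using nR[OF od] pV oS by blast
              then have "Inl (opp d) \<in> C" using dart_opp[OF C] w 1 by blast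
              then have "p (opp d) \<in> X C"
                using XI[OF C, of "p (opp d)" "Inl (opp d)"] False oS pV dart_at[OF od] by blast
              then show ?thesis using 1 True by blast
            qed (use 1 True w in blast)
          next
            case False
            have "w \<in> darts_at (p d)" using 1 dart_at by blast
            moreover from this have "p d \<in> X C" using XI[OF C, of "p d" w] False dS pV w by blast
            ultimately show ?thesis by blast
          qed
        next
          case (2 x)
          have "x \<notin> T" using 2 \<open>w \<notin> U\<close> by (auto simp: T_def)
          moreover have "x \<notin> S" using 2 CZ w by (auto simp: Z_def)
          ultimately have "x \<in> X C" using XI[OF C, of x w] 2 w by blast
          then show ?thesis using 2 by blast
        qed
      qed
      have "Inl d \<in> C" if d: "d \<in> ?T2" for d
      proof -
        have od: "opp d \<in> E \<times> UNIV" using d opp_in_iff by blast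
        have "Inl (opp d) \<in> C" using XC[OF C, of "p (opp d)"] dart_at[OF od] d by blast
        then show ?thesis using dart_opp[OF C _ od] dartT[of d] d by simp
      qed
      then show "?B \<union> Inl ` (?T1 \<union> ?T2) \<subseteq> C" using XC[OF C] by blast
    qed
    have "card C = card ?B + card (Inl ` (?T1 \<union> ?T2) :: (('e \<times> bool) + ('v \<times> nat)) set)"
    proof (subst eq, rule card_Un_disjoint)
      show "finite ?B" using finX finite_cores finite_darts_at by auto
      show "finite (Inl ` (?T1 \<union> ?T2))" using finite_darts by auto
      show "?B \<inter> Inl ` (?T1 \<union> ?T2) = {}" by (auto simp: X_def darts_at_def)
    qed
    also have "card (Inl ` (?T1 \<union> ?T2) :: (('e \<times> bool) + ('v \<times> nat)) set) = card ?T1 + card ?T2"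
    proof -
      have "?T1 \<inter> ?T2 = {}" by (auto simp: X_def)
      then have "card (?T1 \<union> ?T2) = card ?T1 + card ?T2"
        by (intro card_Un_disjoint finite_darts)
      then show ?thesis by (simp add: card_image)
    qed
    also have "card ?B = (\<Sum>x\<in>X C. card (cores x \<union> darts_at x))"
      using finX finite_cores finite_darts_at cores_disjoint
      by (intro card_UN_disjoint) (auto simp: darts_at_def)
    also have "\<dots> = (\<Sum>x\<in>X C. (deg p E x - f x) + deg p E x)"
      using finite_cores finite_darts_at
      by (simp add: card_Un_disjoint cores_darts_at card_cores card_darts_at)
    also have "card ?T2 = dcount p E (X C) T" by (simp add: dcount_sym[of "X C"]) (simp add: dcount_def)
    finally have cC: "card C = (\<Sum>x\<in>X C. (deg p E x - f x) + deg p E x) + (card ?T1 + dcount p E (X C) T)" .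
    have "even (card ?T1)"
    proof (intro even_card_opp_closed finite_darts)
      fix d assume "d \<in> ?T1"
      then show "opp d \<in> ?T1" using dart_opp[OF C, of d] dartT[of "opp d"] opp_in_iff[of d E] by simp
    qed
    moreover have "(\<Sum>x\<in>X C. (deg p E x - f x) + deg p E x) + (\<Sum>x\<in>X C. f x) = (\<Sum>x\<in>X C. 2 * deg p E x)"
      unfolding sum.distrib[symmetric]
    proof (intro sum.cong refl)
      fix x assume "x \<in> X C"
      then show "deg p E x - f x + deg p E x + f x = 2 * deg p E x" using f_le[of x] by (simp add: X_def)
    qed
    then have "even ((\<Sum>x\<in>X C. (deg p E x - f x) + deg p E x) + (\<Sum>x\<in>X C. f x))"
      by (simp add: sum_distrib_left[symmetric])
    ultimately show ?thesis using oc(4)[OF C] unfolding cC by presburger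
  qed
  \<comment> \<open>The parity condition fails for the empty set, so distinct members give distinct
    sets \<open>X C\<close>.\<close>
  have Xne: "X C \<noteq> {}" if "C \<in> \<C>\<^sub>2" for C
    using Xodd[OF that] by (auto simp: dcount_def)
  have C2: "C \<in> \<C>" if "C \<in> \<C>\<^sub>2" for C using that by (simp add: \<C>\<^sub>2_def)
  have injX: "inj_on X \<C>\<^sub>2"
  proof (rule inj_onI)
    fix C C' assume *: "C \<in> \<C>\<^sub>2" "C' \<in> \<C>\<^sub>2" "X C = X C'"
    obtain x where "x \<in> X C" using Xne * by blast
    then show "C = C'" using Xuniq[of C C' x] C2 * by auto
  qed
  have disj: "pairwise disjnt (X ` \<C>\<^sub>2)"
    using Xuniq C2 unfolding pairwise_def disjnt_def by blast
  have cardU: "(\<Sum>x\<in>S. deg p E x) + (\<Sum>x\<in>T. deg p E x - f x) \<le> card U"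
  proof -
    have "(\<Union>x\<in>S. darts_at x) \<union> (\<Union>x\<in>T. cores x) \<subseteq> U" by (auto simp: S_def T_def)
    then have "card ((\<Union>x\<in>S. darts_at x) \<union> (\<Union>x\<in>T. cores x)) \<le> card U" using finU card_mono by blast
    moreover have "card ((\<Union>x\<in>S. darts_at x) \<union> (\<Union>x\<in>T. cores x))
        = card (\<Union>x\<in>S. darts_at x) + card (\<Union>x\<in>T. cores x)"
      using finTS finite_cores finite_darts_at by (intro card_Un_disjoint) (auto simp: darts_at_def)
    moreover have "card (\<Union>x\<in>S. darts_at x) = (\<Sum>x\<in>S. deg p E x)"
      using finTS finite_darts_at darts_at_disjoint by (subst card_UN_disjoint) (auto simp: card_darts_at)
    moreover have "card (\<Union>x\<in>T. cores x) = (\<Sum>x\<in>T. deg p E x - f x)"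
      using finTS finite_cores cores_disjoint by (subst card_UN_disjoint) (auto simp: card_cores)
    ultimately show ?thesis by simp
  qed
  \<comment> \<open>All members are odd and \<open>card W\<close> is even, so \<open>card U\<close>
    and \<open>card \<C>\<close> have the same parity and the strict inequality improves to a gap of
    2.\<close>
  have "card U + 2 \<le> card \<C>"
  proof -
    have "card W = card U + card (\<Union>\<C>)"
      using oc(1) finite_W un finU by (simp add: card_Diff_subset card_mono)
    also have "card (\<Union>\<C>) = (\<Sum>C\<in>\<C>. card C)" using oc(3,5) by (rule card_Union_disjoint)
    finally have "card W = card U + (\<Sum>C\<in>\<C>. card C)" .
    moreover have "even (\<Sum>C\<in>\<C>. card C) = even (card \<C>)"
      using finC oc(4) by (simp add: even_sum_iff) (metis (mono_tags, lifting) Collect_mem_eq Collect_cong)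
    moreover have "even (card W + (\<Sum>x\<in>V. f x))" unfolding card_W by simp
    then have "even (card W)" using ev by simp
    ultimately have "even (card U + card \<C>)" by simp
    then show ?thesis using lt by presburger
  qed
  moreover have "card \<C> = card \<C>\<^sub>1 + card \<C>\<^sub>2"
    unfolding \<C>\<^sub>2_def using finC by (simp add: \<C>\<^sub>1_def card_Diff_subset card_mono)
  moreover have "card \<C>\<^sub>2 = card (X ` \<C>\<^sub>2)" using injX by (simp add: card_image)
  moreover have "(\<Sum>x\<in>A. deg p E x - f x) + (\<Sum>x\<in>A. f x) = (\<Sum>x\<in>A. deg p E x)" if "A \<subseteq> V" for A
    unfolding sum.distrib[symmetric] by (intro sum.cong) (use f_le that in auto)
  note this[OF TS(1)] this[OF TS(2)]
  moreover have "(\<Sum>x\<in>T. deg p E x) = dcount p E T S + dcount p E T (V - S)"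
    using dcount_V[OF finTS(1)] dcount_Un_right[of S "V - S" T] TS(2) by (simp add: Un_absorb1)
  \<comment> \<open>\<open>U\<close> is at least as large as the number of darts at \<open>S\<close>
    and cores at \<open>T\<close>, while \<open>\<C>\<^sub>1\<close> has at most as many members as
    there are cores at \<open>S\<close> and darts from \<open>T\<close> to \<open>S\<close>. The
    degrees at \<open>S\<close> cancel.\<close>
  ultimately have "(\<Sum>x\<in>S. f x) + dcount p E T (V - S) + 2 \<le> (\<Sum>x\<in>T. f x) + card (X ` \<C>\<^sub>2)"
    using cardU cardZ cardC1 by linarith
  moreover have "finite (X ` \<C>\<^sub>2)" using finC by (simp add: \<C>\<^sub>2_def)
  moreover have "\<Union>(X ` \<C>\<^sub>2) \<subseteq> V - S - T" by (auto simp: X_def)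
  moreover have "\<forall>K\<in>X ` \<C>\<^sub>2. dcount p E K (V - S - T - K) = 0 \<and> odd ((\<Sum>x\<in>K. f x) + dcount p E K T)"
    unfolding ball_simps by (intro ballI conjI Xodd Xclosed[OF C2])
  ultimately show ?thesis using TS disj
    by (intro exI[of _ S] exI[of _ T] exI[of _ "X ` \<C>\<^sub>2"] conjI)
qed

end

subsection \<open>Deleting a vertex of a regular graph\<close>

text \<open>Here \<open>s\<close>, \<open>t\<close>, \<open>q\<close> stand for the sizes of
  \<open>S\<close>, \<open>T\<close>, \<open>\<K>\<close>. From \<open>q \<le> A \<le> D\<close>
  follows \<open>s < t\<close>. If \<open>t = s + 1\<close>, both \<open>A\<close> and
  \<open>B\<close> are at most \<open>D\<close>, so \<open>m * q \<le> D\<close>, which forces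
  \<open>q = 0\<close> and contradicts \<open>m \<le> D\<close>. For larger \<open>t\<close> the
  bound on \<open>D\<close> with \<open>B\<close> and \<open>q \<le> B\<close> suffices.\<close>

lemma barrier_arith_even:
  fixes s t q k m r D A B :: nat
  assumes "1 \<le> m" "m < r" "k \<le> m"
    and "k * s + D + 2 \<le> k * t + q" "A \<le> D" "2 * r * t + B \<le> D + 2 * r * (s + 1)" "2 * m * q \<le> A + B"
    and "q \<le> A" "q \<le> B" "t = s + 1 \<Longrightarrow> m \<le> D"
  shows False
proof -
  have "k * s < k * t" using assms by linarith
  then have st: "s < t" by simp
  show False
  proof (cases "t = s + 1")
    case True
    have "m * q + 2 \<le> k + q" using assms True by (simp add: algebra_simps)
    moreover have "m + q \<le> m * q + 1" if "1 \<le> q"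
    proof -
      obtain q' where "q = Suc q'" using \<open>1 \<le> q\<close> by (cases q) auto
      moreover obtain m' where "m = Suc m'" using assms(1) by (cases m) auto
      ultimately show ?thesis by simp
    qed
    ultimately have "q = 0" using assms(3) by linarith
    then show False using assms(3,4,10) True by simp
  next
    case False
    define j where "j = t - s - 1"
    have t: "t = s + j + 1" and j: "1 \<le> j" using st False by (auto simp: j_def)
    have "2 * r * j + B \<le> D" using assms(6) unfolding t by (simp add: algebra_simps)
    moreover have "D + 2 \<le> k * j + k + q" using assms(4) unfolding t by (simp add: algebra_simps)
    moreover have "k * j \<le> r * j" "k \<le> k * j" using assms j by simp_all
    ultimately show False using assms(9) by linarith
  qed
qed

text \<open>Without \<open>q \<le> A\<close> and \<open>q \<le> B\<close> the case
  \<open>t \<le> s\<close> must be excluded too, and \<open>r < 2 * m\<close> does this. Averaging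
  the two bounds on \<open>D\<close> gives \<open>m * q \<le> D + r * (s + 1 - t)\<close> in the
  cases \<open>t \<le> s + 1\<close>.\<close>

lemma barrier_arith_odd:
  fixes s t q k m r D A B :: nat
  assumes "2 \<le> m" "m < r" "k \<le> m" "3 \<le> k" "r < 2 * m"
    and "k * s + D + 2 \<le> k * t + q" "A \<le> D" "2 * r * t + B \<le> D + 2 * r * (s + 1)" "2 * m * q \<le> A + B"
    and "t = s + 1 \<Longrightarrow> m \<le> D"
  shows False
proof -
  obtain m' where m': "m = m' + 1" using assms(1) by (metis Suc_eq_plus1 Suc_le_D numeral_2_eq_2)
  consider "t = s" | "t = s + 1" | "t \<ge> s + 2" | "t < s" by linarith
  then show False
  proof cases
    case 1
    have "m * q \<le> D + r" using assms 1 by (simp add: algebra_simps)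
    moreover have q: "D + 2 \<le> q" using assms 1 by simp
    moreover have "m' * 2 \<le> m' * q" using q by simp
    moreover have "m * q = m' * q + q" using m' by simp
    ultimately show False using assms(5) m' by linarith
  next
    case 2
    have "m * q + 2 \<le> k + q" using assms 2 by (simp add: algebra_simps)
    moreover have "m * q = m' * q + q" using m' by simp
    moreover have "m' \<le> m' * q" if "1 \<le> q" using that by simp
    ultimately have "q = 0" using assms(3) m' by linarith
    then show False using assms(3,6,10) 2 by simp
  next
    case 3
    define j where "j = t - s - 1"
    have t: "t = s + j + 1" and j: "1 \<le> j" using 3 by (auto simp: j_def)
    have D1: "2 * r * j + B \<le> D" using assms(8) unfolding t by (simp add: algebra_simps)
    have D2: "D + 2 \<le> k * j + k + q" using assms(6) unfolding t by (simp add: algebra_simps)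
    show False
    proof (cases "2 * k \<le> r")
      case True
      \<comment> \<open>The plain average \<open>D \<ge> r * j + m * q\<close> is already strong
        enough here.\<close>
      have "2 * k * j \<le> r * j" using True by (rule mult_right_mono) simp
      moreover have "k \<le> k * j" using j by simp
      moreover have "q \<le> m * q" using assms(1) by simp
      ultimately show False using D1 D2 assms(7,9) by linarith
    next
      case False
      \<comment> \<open>Combine the two lower bounds for \<open>D\<close> with weights \<open>k\<close> and \<open>r - k\<close>.\<close>
      define l where "l = r - k"
      have r: "r = k + l" and l: "1 \<le> l" "l \<le> k" using assms(2,3) False by (auto simp: l_def)
      have "2 * (k * (r * j)) + k * B \<le> k * D"
        using mult_le_mono2[OF D1, of k] by (simp add: distrib_left mult.left_commute mult.assoc)
      moreover have "l * A \<le> l * D" using assms(7) by simp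
      moreover have "l * B \<le> k * B" using l by simp
      moreover have "2 * (l * (m * q)) \<le> l * A + l * B"
        using mult_le_mono2[OF assms(9), of l] by (simp add: distrib_left mult.left_commute mult.assoc)
      moreover have "r * q \<le> 2 * (m * q)"
        using mult_le_mono1[of r "2 * m" q] assms(5) by (simp add: mult.assoc)
      moreover have "m * q \<le> l * (m * q)" using l by simp
      moreover have "r * D + 2 * r \<le> k * (r * j) + r * k + r * q"
        using mult_le_mono2[OF D2, of r] by (simp add: distrib_left mult.left_commute mult.commute)
      moreover have "r * k \<le> k * (r * j)" using j by (simp add: mult.left_commute)
      moreover have "r * D = k * D + l * D" unfolding r by (rule distrib_right)
      ultimately show False using assms(2) by linarith
    qed
  next
    case 4
    define j where "j = s - t"
    have s: "s = t + j" and j: "1 \<le> j" using 4 by (auto simp: j_def)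
    have D1: "B \<le> D + 2 * r * j + 2 * r" using assms(8) unfolding s by (simp add: algebra_simps)
    have D2: "k * j + D + 2 \<le> q" using assms(6) unfolding s by (simp add: algebra_simps)
    have "m * q \<le> D + r * j + r" using D1 assms(7,9) by linarith
    moreover have "m' * (k * j + 2) \<le> m' * q" by (rule mult_le_mono2) (use D2 in linarith)
    moreover have "m * q = m' * q + q" using m' by simp
    \<comment> \<open>\<open>D\<close> cancels because \<open>q\<close> exceeds it by at least
      \<open>k * j + 2\<close>; what remains contradicts \<open>r \<le> m * k\<close> and
      \<open>r < 2 * m\<close>.\<close>
    ultimately have "m' * (k * j) + k * j + 2 * m \<le> r * j + r" using D2 m' by simp
    moreover have "m' * (k * j) + k * j = m * k * j" using m' by (simp add: algebra_simps)
    moreover have "r * j \<le> m * k * j"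
    proof -
      have "m * 2 \<le> m * k" using assms(4) by simp
      then have "r \<le> m * k" using assms(5) by linarith
      then show ?thesis by simp
    qed
    ultimately show False using assms(5) by linarith
  qed
qed

section \<open>Edge cuts and factors in regular dart graphs\<close>

context dart_graph begin

lemma dcount_V_regular:
  assumes reg: "\<And>x. x \<in> V \<Longrightarrow> deg p E x = d" and X: "X \<subseteq> V"
  shows "dcount p E X V = d * card X"
proof -
  have "dcount p E X V = (\<Sum>x\<in>X. deg p E x)" using dcount_V finite_subset[OF X finite_V] .
  also have "\<dots> = (\<Sum>x\<in>X. d)" using reg X by (intro sum.cong) auto
  finally show ?thesis by simp
qed

text \<open>The degree sum of \<open>K\<close> is even and counts each edge inside \<open>K\<close>
  twice.\<close>

lemma even_boundary:
  assumes reg: "\<And>x. x \<in> V \<Longrightarrow> deg p E x = 2 * r" and K: "K \<subseteq> V"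
  shows "even (dcount p E K (V - K))"
proof -
  have "dcount p E K V = 2 * r * card K" by (rule dcount_V_regular[OF reg K])
  then have "even (dcount p E K V)" by simp
  moreover have "dcount p E K V = dcount p E K K + dcount p E K (V - K)"
    using dcount_Un_right[of K "V - K" K] K by (simp add: Un_absorb1)
  ultimately show ?thesis using even_dcount_self[of K] by simp
qed

text \<open>The theorem in the language of darts, with edge-connectivity as the cut condition
  \<open>cut\<close>. The factor theorem is applied to the graph without \<open>v\<close>, and its
  sets are then measured in the whole graph.\<close>

lemma delete_vertex_factor:
  fixes m r k :: nat and v :: 'v
  assumes reg: "\<And>x. x \<in> V \<Longrightarrow> deg p E x = 2 * r"
    and cut: "\<And>X. X \<subseteq> V \<Longrightarrow> X \<noteq> {} \<Longrightarrow> X \<noteq> V \<Longrightarrow> 2 * m \<le> dcount p E X (V - X)"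
    and odd: "odd (card V)" and v: "v \<in> V"
    and mr: "2 \<le> m" "m < r"
    and k: "(even k \<and> 2 \<le> k \<and> k \<le> m) \<or> (odd k \<and> 3 \<le> k \<and> k \<le> m \<and> 2 * m > r)"
  shows "\<exists>F \<subseteq> {e \<in> E. p (e, True) \<noteq> v \<and> p (e, False) \<noteq> v}. \<forall>x\<in>V - {v}. deg p F x = k"
proof (rule ccontr)
  define E' where "E' = {e \<in> E. p (e, True) \<noteq> v \<and> p (e, False) \<noteq> v}"
  define V' where "V' = V - {v}"
  assume "\<not> ?thesis"
  then have no: "\<not> (\<exists>F\<subseteq>E'. \<forall>x\<in>V'. deg p F x = k)" by (simp add: E'_def V'_def)
  have km: "k \<le> m" using k by auto
  have E'_iff: "d \<in> E' \<times> UNIV \<longleftrightarrow> d \<in> E \<times> UNIV \<and> p d \<noteq> v \<and> p (opp d) \<noteq> v" for d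
    unfolding E'_def by (cases d; cases "snd d") auto
  have VV: "V = insert v V'" "v \<notin> V'" using v by (auto simp: V'_def)
  have finV': "finite V'" using finite_V by (simp add: V'_def)
  interpret G': dart_graph V' E' p
  proof
    show "finite E'" using finite_E by (simp add: E'_def)
    show "p d \<in> V'" if "d \<in> E' \<times> UNIV" for d using that p_in[of d] unfolding E'_iff V'_def by blast
  qed (rule finV')
  let ?n = "dcount p E"
  have n': "dcount p E' X Y = ?n X Y" if "X \<subseteq> V'" "Y \<subseteq> V'" for X Y
  proof -
    have "{d \<in> E' \<times> UNIV. p d \<in> X \<and> p (opp d) \<in> Y} = {d \<in> E \<times> UNIV. p d \<in> X \<and> p (opp d) \<in> Y}"
    proof (rule Collect_cong)
      fix d
      show "(d \<in> E' \<times> UNIV \<and> p d \<in> X \<and> p (opp d) \<in> Y) = (d \<in> E \<times> UNIV \<and> p d \<in> X \<and> p (opp d) \<in> Y)"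
        unfolding E'_iff using that VV(2) by blast
    qed
    then show ?thesis by (simp only: dcount_def)
  qed
  have nV: "?n X V = 2 * r * card X" if "X \<subseteq> V" for X
    by (rule dcount_V_regular[OF reg that])
  \<comment> \<open>The factor theorem needs degrees of at least \<open>k\<close>. By the cut around
    \<open>{v, x}\<close>, which is not all of \<open>V\<close> because \<open>card V\<close> is
    odd, at most \<open>2 * r - m\<close> edges join \<open>v\<close> and \<open>x\<close>, so
    \<open>x\<close> keeps degree at least \<open>m\<close>.\<close>
  have deg': "k \<le> deg p E' x" if x: "x \<in> V'" for x
  proof -
    let ?R = "V - {v, x}"
    have "card V \<noteq> card {v, x}" using odd x VV(2) by (auto simp: card_insert_if)
    then have "2 * m \<le> ?n {v, x} ?R" using cut[of "{v, x}"] x v by (auto simp: V'_def)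
    also have "?n {v, x} ?R = ?n {v} ?R + ?n {x} ?R"
      using dcount_Un_left[of "{v}" "{x}" ?R] x VV(2) by (auto simp: insert_commute)
    finally have 1: "2 * m \<le> ?n {v} ?R + ?n {x} ?R" .
    have 2: "?n {v} {x} + ?n {v} ?R \<le> 2 * r"
      using dcount_Un_right[of "{x}" ?R "{v}"] dcount_mono[of "{v}" "{v}" "{x} \<union> ?R" V] nV[of "{v}"] v x
      by (auto simp: V'_def)
    have 3: "?n {x} {v} + ?n {x} ?R \<le> 2 * r"
      using dcount_Un_right[of "{v}" ?R "{x}"] dcount_mono[of "{x}" "{x}" "{v} \<union> ?R" V] nV[of "{x}"] v x
      by (auto simp: V'_def)
    have "?n {x} V = ?n {x} {v} + ?n {x} V'"
      using dcount_Un_right[of "{v}" V' "{x}"] VV by simp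
    moreover have "?n {x} V' = deg p E' x"
      using G'.dcount_V[of "{x}"] n'[of "{x}" V'] x by simp
    ultimately show ?thesis using 1 2 3 nV[of "{x}"] x VV dcount_sym[of "{x}" "{v}"] km by auto
  qed
  interpret G': factor_gadget V' E' p "\<lambda>_. k"
    using deg' by unfold_locales
  have cV': "card V = Suc (card V')" using VV finV' by simp
  \<comment> \<open>\<open>card V'\<close> is even, hence so is the sum of the constant
    \<open>k\<close> over \<open>V'\<close>.\<close>
  obtain S T \<K> where S: "S \<subseteq> V'" and T: "T \<subseteq> V'" and ST: "S \<inter> T = {}" and finK: "finite \<K>"
    and dK: "pairwise disjnt \<K>" and KW: "\<Union>\<K> \<subseteq> V' - S - T"
    and K: "\<And>K. K \<in> \<K> \<Longrightarrow> dcount p E' K (V' - S - T - K) = 0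
        \<and> odd ((\<Sum>x\<in>K. k) + dcount p E' K T)"
    and ineq: "(\<Sum>x\<in>S. k) + dcount p E' T (V' - S) + 2 \<le> (\<Sum>x\<in>T. k) + card \<K>"
    using G'.factor_barrier[OF no] odd cV' by (auto simp: sum_constant)
  \<comment> \<open>The deleted vertex is counted with \<open>S\<close>, so \<open>V\<close> splits
    into \<open>Q\<close>, \<open>T\<close> and \<open>W\<close>, and every edge leaving a set
    \<open>K\<close> ends in \<open>T\<close> or \<open>Q\<close>.\<close>
  define Q where "Q = insert v S"
  define W where "W = V' - S - T"
  define D where "D = ?n T (V' - S)"
  have fin: "finite S" "finite T" "finite W" using S T finV' finite_subset by (auto simp: W_def)
  have cQ: "card Q = card S + 1" using fin S VV(2) by (auto simp: Q_def card_insert_if)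
  have part: "V = Q \<union> (V' - S)" "Q \<inter> (V' - S) = {}" using S VV by (auto simp: Q_def)
  have TV: "T \<subseteq> V" using T VV by blast
  have DT: "D + ?n T Q = 2 * r * card T"
    using dcount_Un_right[OF part(2), of T, folded part(1)] nV[OF TV] unfolding D_def by simp
  have D1: "?n X T \<le> D" if "X \<subseteq> W" for X
    unfolding D_def dcount_sym[of X T] using that by (intro dcount_mono) (auto simp: W_def)
  \<comment> \<open>The edges from \<open>Q\<close> to \<open>T\<close> and to \<open>X\<close>
    together are limited by the degree sum of \<open>Q\<close>; those from \<open>T\<close> to
    \<open>Q\<close> are what \<open>D\<close> lacks from the degree sum of
    \<open>T\<close>.\<close>
  have D2: "2 * r * card T + ?n X Q \<le> D + 2 * r * (card S + 1)" if X: "X \<subseteq> W" for X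
  proof -
    have "?n Q T + ?n Q X = ?n Q (T \<union> X)"
      using X by (intro dcount_Un_right[symmetric]) (auto simp: W_def)
    also have "\<dots> \<le> ?n Q V"
      using X T S VV by (intro dcount_mono) (auto simp: W_def)
    also have "\<dots> = 2 * r * (card S + 1)" using nV[of Q] cQ S VV by (auto simp: Q_def)
    finally show ?thesis using DT dcount_sym[of T Q] dcount_sym[of X Q] by linarith
  qed
  have boundary: "?n X (V - X) = ?n X T + ?n X Q" if X: "X \<subseteq> W" "?n X (W - X) = 0" for X
  proof -
    have "V - X = T \<union> (Q \<union> (W - X))" using S T VV X by (auto simp: W_def Q_def)
    moreover have "T \<inter> (Q \<union> (W - X)) = {}" "Q \<inter> (W - X) = {}"
      using S T VV ST by (auto simp: W_def Q_def)
    ultimately show ?thesis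
      using dcount_Un_right[of T "Q \<union> (W - X)" X] dcount_Un_right[of Q "W - X" X] X by simp
  qed
  have WV: "W \<subseteq> V" "v \<notin> W" using VV by (auto simp: W_def)
  have cutW: "2 * m \<le> ?n X T + ?n X Q" if X: "X \<subseteq> W" "?n X (W - X) = 0" "X \<noteq> {}" for X
  proof -
    have "X \<subseteq> V" "X \<noteq> V" using X WV v by auto
    then show ?thesis using cut[of X] X boundary[of X] by simp
  qed
  have KK: "K \<subseteq> W" "?n K (W - K) = 0" "odd (k * card K + ?n K T)" "K \<noteq> {}" if "K \<in> \<K>" for K
  proof -
    show 1: "K \<subseteq> W" using KW that by (auto simp: W_def)
    have sub: "K \<subseteq> V'" "W - K \<subseteq> V'" using 1 by (auto simp: W_def)
    show "?n K (W - K) = 0" using K[OF that] n'[OF sub] by (simp add: W_def)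
    show o: "odd (k * card K + ?n K T)" using K[OF that] n'[OF sub(1) T] by (simp add: mult.commute)
    show "K \<noteq> {}" using o by (auto simp: dcount_def)
  qed
  have UK: "\<Union>\<K> \<subseteq> W" using KW by (simp add: W_def)
  let ?A = "?n (\<Union>\<K>) T" and ?B = "?n (\<Union>\<K>) Q" and ?q = "card \<K>"
  have sums: "?A = (\<Sum>K\<in>\<K>. ?n K T)" "?B = (\<Sum>K\<in>\<K>. ?n K Q)"
    using dcount_Union_left[OF finK dK] by auto
  have AB: "2 * m * ?q \<le> ?A + ?B"
  proof -
    have "(\<Sum>K\<in>\<K>. 2 * m) \<le> (\<Sum>K\<in>\<K>. ?n K T + ?n K Q)"
      by (intro sum_mono cutW KK)
    then show ?thesis unfolding sums by (simp add: sum.distrib mult.commute)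
  qed
  have main: "k * card S + D + 2 \<le> k * card T + ?q"
    using ineq n'[of T "V' - S"] T unfolding D_def by (auto simp: mult.commute)
  \<comment> \<open>The order of \<open>W\<close> is odd, so \<open>W\<close> is nonempty and its
    cut has at least \<open>2 * m\<close> edges; \<open>D1\<close> and \<open>D2\<close> bound both
    parts of the cut by \<open>D\<close>.\<close>
  have large_D: "m \<le> D" if ts: "card T = card S + 1"
  proof -
    have "card V' = card S + card T + card W"
    proof -
      have "V' = (S \<union> T) \<union> W" "(S \<union> T) \<inter> W = {}" using S T by (auto simp: W_def)
      then have "card V' = card (S \<union> T) + card W" using fin card_Un_disjoint[of "S \<union> T" W] by simp
      then show ?thesis using card_Un_disjoint[OF fin(1,2) ST] by simp
    qed
    then have "odd (card W)" using odd cV' ts by simp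
    then have "W \<noteq> {}" by auto
    moreover have "?n W (W - W) = 0" by (simp add: dcount_def)
    ultimately have "2 * m \<le> ?n W T + ?n W Q" using cutW by blast
    then show ?thesis using D1[of W] D2[of W] ts by simp
  qed
  show False
  proof (cases "even k")
    case True
    \<comment> \<open>For even \<open>k\<close> the number of edges from \<open>K\<close> to
      \<open>T\<close> is odd, and as the boundary of \<open>K\<close> is even, so is the number of
      those to \<open>Q\<close> odd. Both are therefore positive.\<close>
    have pos: "1 \<le> ?n K T" "1 \<le> ?n K Q" if "K \<in> \<K>" for K
    proof -
      have o: "odd (?n K T)" using KK(3)[OF that] True by simp
      have "even (?n K T + ?n K Q)"
        using even_boundary[OF reg, of K] boundary[OF KK(1,2)[OF that]] KK(1)[OF that] WV by auto
      then have "odd (?n K Q)" using o by simp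
      then show "1 \<le> ?n K T" "1 \<le> ?n K Q" using o by (auto simp: Suc_le_eq odd_pos)
    qed
    have "(\<Sum>K\<in>\<K>. 1) \<le> ?A" "(\<Sum>K\<in>\<K>. 1) \<le> ?B"
      unfolding sums using pos by (simp_all only: sum_mono)
    then have "?q \<le> ?A" "?q \<le> ?B" by simp_all
    moreover have "1 \<le> m" using mr by simp
    ultimately show False
      using barrier_arith_even[OF _ mr(2) km main D1[OF UK] D2[OF UK] AB _ _ large_D] by simp
  next
    case False
    then have "3 \<le> k" "r < 2 * m" using k by auto
    then show False
      by (rule barrier_arith_odd[OF mr km _ _ main D1[OF UK] D2[OF UK] AB large_D])
  qed
qed

end

subsection \<open>Multigraphs as dart graphs\<close>

text \<open>An arbitrary order of the two ends of every edge, which places the darts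
  \<open>(e, True)\<close> and \<open>(e, False)\<close>.\<close>

lemma ex_dart_heads: "\<exists>p. \<forall>e. ends G e = Upair (p (e, True)) (p (e, False))"
proof -
  have "\<forall>e. \<exists>a b. ends G e = Upair a b" by (metis uprod_exhaust)
  then obtain a b where "\<And>e. ends G e = Upair (a e) (b e)" by metis
  then have "\<forall>e. ends G e = Upair (case_prod (\<lambda>e c. if c then a e else b e) (e, True))
      (case_prod (\<lambda>e c. if c then a e else b e) (e, False))" by simp
  then show ?thesis by blast
qed

text \<open>Inclusion and exclusion: the edges with first end \<open>x\<close> and those with second
  end \<open>x\<close> have the edges at \<open>x\<close> as union and the loops at \<open>x\<close>
  as intersection.\<close>

lemma degree_eq_deg:
  fixes H :: "('v, 'e) multigraph"
  assumes fin: "finite (edges H)"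
    and p: "\<And>e. e \<in> edges H \<Longrightarrow> ends H e = Upair (p (e, True)) (p (e, False))"
  shows "degree H x = deg p (edges H) x"
proof -
  let ?A = "{e \<in> edges H. p (e, True) = x}" and ?B = "{e \<in> edges H. p (e, False) = x}"
  have "{e \<in> edges H. x \<in> set_uprod (ends H e)} = ?A \<union> ?B" using p by auto
  moreover have "{e \<in> edges H. ends H e = Upair x x} = ?A \<inter> ?B" using p by auto
  moreover have "{d \<in> edges H \<times> UNIV. p d = x} = (\<lambda>e. (e, True)) ` ?A \<union> (\<lambda>e. (e, False)) ` ?B"
  proof (rule set_eqI)
    fix d :: "'e \<times> bool"
    obtain e c where "d = (e, c)" by (cases d)
    then show "d \<in> {d \<in> edges H \<times> UNIV. p d = x} \<longleftrightarrow> d \<in> (\<lambda>e. (e, True)) ` ?A \<union> (\<lambda>e. (e, False)) ` ?B"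
      by (cases c) auto
  qed
  moreover have "card ((\<lambda>e. (e, True)) ` ?A \<union> (\<lambda>e. (e, False)) ` ?B) = card ?A + card ?B"
    using fin by (subst card_Un_disjoint) (auto simp: card_image inj_on_def)
  ultimately show ?thesis
    using card_Un_Int[of ?A ?B] fin by (simp add: degree_def deg_def)
qed

text \<open>Once the edges leaving \<open>X\<close> are deleted, no path leads out of
  \<open>X\<close>, so there cannot be fewer than \<open>l\<close> of them.\<close>

lemma edge_connected_boundary:
  assumes "finite_multigraph G" and conn: "edge_connected l G"
    and p: "\<And>e. e \<in> edges G \<Longrightarrow> ends G e = Upair (p (e, True)) (p (e, False))"
    and X: "X \<subseteq> verts G" "X \<noteq> {}" "X \<noteq> verts G"
  shows "l \<le> dcount p (edges G) X (verts G - X)"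
proof (rule ccontr)
  assume less: "\<not> ?thesis"
  let ?D = "{d \<in> edges G \<times> UNIV. p d \<in> X \<and> p (opp d) \<in> verts G - X}"
  have finE: "finite (edges G)" using assms(1) by (simp add: finite_multigraph_def)
  have finD: "finite ?D" by (rule finite_subset[of _ "edges G \<times> UNIV"]) (use finE in auto)
  have "card (fst ` ?D) \<le> card ?D" using finD by (rule card_image_le)
  then have "card (fst ` ?D) < l" using less by (simp add: dcount_def)
  moreover have "fst ` ?D \<subseteq> edges G" by auto
  ultimately have c: "connected (delete_edges G (fst ` ?D))" using conn by (simp add: edge_connected_def)
  obtain x y where x: "x \<in> X" and y: "y \<in> verts G - X" using X by blast
  then have "(x, y) \<in> (adjacency (delete_edges G (fst ` ?D)))\<^sup>*"
    using c X(1) by (auto simp: connected_def delete_edges_def)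
  then have "y \<in> X"
  proof (induction rule: rtrancl_induct)
    case base show ?case by (rule x)
  next
    case (step u w)
    then obtain e where e: "e \<in> edges G" "e \<notin> fst ` ?D" "ends G e = Upair u w"
      by (auto simp: adjacency_def delete_edges_def)
    then have w: "w \<in> verts G"
      using finite_multigraph.ends_in_verts[OF assms(1) e(1)] by simp
    have "\<exists>c. p (e, c) = u \<and> p (opp (e, c)) = w"
    proof -
      have "(p (e, True) = u \<and> p (e, False) = w) \<or> (p (e, False) = u \<and> p (e, True) = w)"
        using p[OF e(1)] e(3) by auto
      then show ?thesis by (metis opp.simps)
    qed
    then obtain c where c: "p (e, c) = u" "p (opp (e, c)) = w" by blast
    show ?case
    proof (rule ccontr)
      assume "w \<notin> X"
      then have "(e, c) \<in> ?D" using c w e step by auto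
      then show False using e(2) by force
    qed
  qed
  then show False using y by simp
qed

theorem theorem2p1:
  fixes G :: "('v, 'e) multigraph" and m r k :: nat
  assumes "2 \<le> m" and "m < r" and "0 < k"
    and "finite_multigraph G"
    and "regular (2 * r) G"
    and "edge_connected (2 * m) G"
    and "odd (card (verts G))"
    and "(even k \<and> 2 \<le> k \<and> k \<le> m) \<or> (odd k \<and> 3 \<le> k \<and> k \<le> m \<and> 2 * m > r)"
  shows "\<forall>v \<in> verts G. has_factor k (delete_vertex G v)"
proof
  fix v assume v: "v \<in> verts G"
  obtain p where p: "\<And>e. ends G e = Upair (p (e, True)) (p (e, False))"
    using ex_dart_heads[of G] by blast
  have finE: "finite (edges G)" using assms(4) by (simp add: finite_multigraph_def)
  interpret dart_graph "verts G" "edges G" p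
  proof
    fix d :: "'e \<times> bool" assume d: "d \<in> edges G \<times> UNIV"
    obtain e c where ec: "d = (e, c)" by (cases d)
    have "set_uprod (ends G e) \<subseteq> verts G" using d ec assms(4) by (simp add: finite_multigraph_def)
    then show "p d \<in> verts G" using p[of e] ec by (cases c) auto
  qed (use assms(4) in \<open>auto simp: finite_multigraph_def\<close>)
  have reg: "deg p (edges G) x = 2 * r" if "x \<in> verts G" for x
    using degree_eq_deg[OF finE p] assms(5) that by (simp add: regular_def)
  have cut: "2 * m \<le> dcount p (edges G) X (verts G - X)"
    if "X \<subseteq> verts G" "X \<noteq> {}" "X \<noteq> verts G" for X
    by (rule edge_connected_boundary[OF assms(4,6) p that])
  obtain F where F: "F \<subseteq> {e \<in> edges G. p (e, True) \<noteq> v \<and> p (e, False) \<noteq> v}"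
    and degF: "\<And>x. x \<in> verts G - {v} \<Longrightarrow> deg p F x = k"
    using delete_vertex_factor[OF reg cut assms(7) v assms(1,2,8)] by blast
  define H where "H = G\<lparr>verts := verts G - {v}, edges := F\<rparr>"
  have H: "verts H = verts G - {v}" "edges H = F" "ends H = ends G" by (simp_all add: H_def)
  have "F \<subseteq> edges G" using F by blast
  then have finF: "finite F" using finE finite_subset by blast
  have "spanning_subgraph H (delete_vertex G v)"
    using F p unfolding spanning_subgraph_def delete_vertex_def H by auto
  moreover have "degree H x = k" if "x \<in> verts G - {v}" for x
    using degree_eq_deg[of H p x] H finF p degF[OF that] by simp
  ultimately show "has_factor k (delete_vertex G v)"
    unfolding has_factor_def is_factor_def by (intro exI[of _ H]) (simp add: delete_vertex_def)
qed

end
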